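(* Let $V$ be an interaction potential as in the context, and let $\rho=\rho_{N,J}$ be the law of the dry set under the $\delta$-pinned measure $\hat{\mathbb P}_N$ with pinning parameter $J$. For each $J\in\mathbb R$ there exist a number $R=R(J)<\infty$ and an exponent $\nu=\nu(J)>0$ (both may also depend on $c_V$, but not on $N$ or $B$) such that the following holds for every $N\in\mathbb N$. Whenever a finite set $B\subset\mathbb Z^2$ admits a decomposition $B=B_1\vee\dots\vee B_n$ into disjoint connected components $B_1,\dots,B_n$ with $$\mathrm{diam}(B_l)\ge R,\qquad l=1,\dots,n,$$ one has $$\sum_{A:\,A\cap B=\emptyset}\rho(A)\le e^{-\nu|B|}.$$
   Context: Potential: $V:\mathbb R\to\mathbb R$ is even and smooth, and there is a constant $c_V\ge 1$ with $\frac1{c_V}\le V''(t)\le c_V$ for all $t\in\mathbb R$. Hamiltonian: formally $\mathcal H(\phi)=\sum_{i\sim j}V(\phi_i-\phi_j)$, the sum being over nearest-neighbour pairs (unordered) of $\mathbb Z^2$. In a finite box $\Lambda_N=[-N,\dots,N]^2\subset\mathbb Z^2$ with heights fixed to $0$ outside, the sum is restricted to pairs with at least one endpoint in $\Lambda_N$ (the other terms are constants absorbed in the normalization). Pinned measure: for $J\in\mathbb R$, $$\hat{\mathbb P}_N(d\phi)=\frac1{\hat{\mathbf Z}_N}e^{-\mathcal H(\phi)}\prod_{i\in\Lambda_N}\bigl(d\phi_i+e^J\delta_0(d\phi_i)\bigr)\prod_{j\in\mathbb Z^2\setminus\Lambda_N}\delta_0(d\phi_j),$$ where $d\phi_i$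 is Lebesgue measure, $\delta_0$ is the Dirac mass at $0$, and $\hat{\mathbf Z}_N$ is the normalizing constant. Dry set: $\mathcal A=\{i\in\mathbb Z^2:\phi_i=0\}$, and $\rho(A)=\rho_{N,J}(A)=\hat{\mathbb P}_N(\mathcal A=A)$ for $A\subset\mathbb Z^2$; it vanishes unless $A\supset\mathbb Z^2\setminus\Lambda_N$, so sums over $A$ are finite sums over such sets. All estimates are uniform in $N$. Connectedness is with respect to the nearest-neighbour graph structure of $\mathbb Z^2$; the diameter is taken with respect to the sup norm; $|B|$ is the cardinality of $B$. *)

theory Defs
  imports "HOL-Probability.Probability"
begin

section \<open>The lattice\<close>

type_synonym site = "int \<times> int"

definition nbr :: "site \<Rightarrow> site \<Rightarrow> bool" where
  "nbr i j \<longleftrightarrow> \<bar>fst i - fst j\<bar> + \<bar>snd i - snd j\<bar> = 1"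

definition lattice_box :: "nat \<Rightarrow> site set" where
  "lattice_box N = {- int N..int N} \<times> {- int N..int N}"

definition lattice_connected :: "site set \<Rightarrow> bool" where
  "lattice_connected C \<longleftrightarrow>
     C \<noteq> {} \<and> (\<forall>i\<in>C. \<forall>j\<in>C. (i, j) \<in> {(x, y). x \<in> C \<and> y \<in> C \<and> nbr x y}\<^sup>*)"

definition connected_comp :: "site set \<Rightarrow> site set \<Rightarrow> bool" where
  "connected_comp B C \<longleftrightarrow>
     C \<subseteq> B \<and> lattice_connected C \<and>
     (\<forall>D. C \<subseteq> D \<and> D \<subseteq> B \<and> lattice_connected D \<longrightarrow> D = C)"

text \<open>
  The library metric on pairs is Euclidean, so the sup-norm diameter is written out; it is only
  meaningful for finite nonempty sets.
\<close>

definition sup_diam :: "site set \<Rightarrow> real" where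
  "sup_diam C = Max ((\<lambda>(i, j). real_of_int (max \<bar>fst i - fst j\<bar> \<bar>snd i - snd j\<bar>)) ` (C \<times> C))"


section \<open>The pinned interface\<close>

definition interaction_potential :: "real \<Rightarrow> (real \<Rightarrow> real) \<Rightarrow> bool" where
  "interaction_potential c V \<longleftrightarrow>
     c \<ge> 1 \<and>
     (\<forall>t. V (- t) = V t) \<and>
     (\<forall>n. (deriv ^^ n) V differentiable_on UNIV) \<and>
     (\<forall>t. 1 / c \<le> deriv (deriv V) t \<and> deriv (deriv V) t \<le> c)"

text \<open>
  The factor \<open>1 / 2\<close> turns the sum over ordered pairs into the sum over unordered
  nearest-neighbour pairs, since \<open>V\<close> is even.
\<close>

definition hamiltonian :: "nat \<Rightarrow> (real \<Rightarrow> real) \<Rightarrow> (site \<Rightarrow> real) \<Rightarrow> real" where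
  "hamiltonian N V \<phi> =
     1 / 2 * (\<Sum>(i, j) | nbr i j \<and> (i \<in> lattice_box N \<or> j \<in> lattice_box N). V (\<phi> i - \<phi> j))"

text \<open>Lebesgue measure plus an atom of mass \<open>exp J\<close> at 0.\<close>

definition site_measure :: "real \<Rightarrow> real measure" where
  "site_measure J =
     measure_of UNIV (sets borel)
       (\<lambda>S. emeasure lborel S + ennreal (exp J) * emeasure (return borel 0) S)"

text \<open>
  The Dirac masses at 0 outside the box are realised by pushing the finite product forward under
  extension by 0.
\<close>

definition reference_measure :: "nat \<Rightarrow> real \<Rightarrow> (site \<Rightarrow> real) measure" where
  "reference_measure N J =
     distr (Pi\<^sub>M (lattice_box N) (\<lambda>_. site_measure J)) (Pi\<^sub>M UNIV (\<lambda>_. borel))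
       (\<lambda>\<phi> i. if i \<in> lattice_box N then \<phi> i else 0)"

definition partition_function :: "nat \<Rightarrow> (real \<Rightarrow> real) \<Rightarrow> real \<Rightarrow> ennreal" where
  "partition_function N V J =
     (\<integral>\<^sup>+ \<phi>. ennreal (exp (- hamiltonian N V \<phi>)) \<partial>reference_measure N J)"

definition pinned_measure :: "nat \<Rightarrow> (real \<Rightarrow> real) \<Rightarrow> real \<Rightarrow> (site \<Rightarrow> real) measure" where
  "pinned_measure N V J =
     density (reference_measure N J)
       (\<lambda>\<phi>. ennreal (exp (- hamiltonian N V \<phi>)) / partition_function N V J)"

definition dry_set :: "(site \<Rightarrow> real) \<Rightarrow> site set" where
  "dry_set \<phi> = {i. \<phi> i = 0}"

definition dry_law :: "nat \<Rightarrow> (real \<Rightarrow> real) \<Rightarrow> real \<Rightarrow> site set \<Rightarrow> real" where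
  "dry_law N V J A = measure (pinned_measure N V J) {\<phi>. dry_set \<phi> = A}"


section \<open>Sanity checks\<close>

lemma sets_site_measure [simp, measurable_cong]: "sets (site_measure J) = sets borel"
  unfolding site_measure_def using sets.sigma_sets_eq[of "borel :: real measure"] by simp

lemma space_site_measure [simp]: "space (site_measure J) = UNIV"
  unfolding site_measure_def by (simp add: space_measure_of_conv)

lemma emeasure_site_measure:
  assumes "S \<in> sets borel"
  shows "emeasure (site_measure J) S = emeasure lborel S + ennreal (exp J) * indicator S 0"
proof -
  have "emeasure (site_measure J) S =
      emeasure lborel S + ennreal (exp J) * emeasure (return borel (0::real)) S"
  proof (rule emeasure_measure_of[OF site_measure_def])
    show "countably_additive (sets (site_measure J))
      (\<lambda>S. emeasure lborel S + ennreal (exp J) * emeasure (return borel 0) S)"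
      unfolding countably_additive_def
    proof (intro allI impI)
      fix F :: "nat \<Rightarrow> real set"
      assume F: "range F \<subseteq> sets (site_measure J)" "disjoint_family F"
      have 1: "(\<Sum>i. emeasure lborel (F i)) = emeasure lborel (\<Union> (range F))"
        using F by (intro suminf_emeasure) auto
      have 2: "(\<Sum>i. emeasure (return borel 0) (F i)) = emeasure (return borel 0) (\<Union> (range F))"
        using F by (intro suminf_emeasure) auto
      have "(\<Sum>i. emeasure lborel (F i) + ennreal (exp J) * emeasure (return borel 0) (F i)) =
        (\<Sum>i. emeasure lborel (F i)) + ennreal (exp J) * (\<Sum>i. emeasure (return borel 0) (F i))"
        by (simp only: suminf_add[symmetric] summableI ennreal_suminf_cmult)
      then show "(\<Sum>i. emeasure lborel (F i) + ennreal (exp J) * emeasure (return borel 0) (F i)) =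
        emeasure lborel (\<Union> (range F)) +
          ennreal (exp J) * emeasure (return borel 0) (\<Union> (range F))"
        by (simp only: 1 2)
    qed
  qed (use assms in \<open>auto simp: positive_def\<close>)
  then show ?thesis
    using assms by simp
qed

lemma measurable_zero_extension:
  "(\<lambda>\<phi> i. if i \<in> lattice_box N then \<phi> i else 0)
     \<in> Pi\<^sub>M (lattice_box N) (\<lambda>_. site_measure J) \<rightarrow>\<^sub>M Pi\<^sub>M UNIV (\<lambda>_. borel)"
proof (rule measurable_PiM_single')
  fix i :: site
  show "(\<lambda>\<phi>. if i \<in> lattice_box N then \<phi> i else 0)
      \<in> Pi\<^sub>M (lattice_box N) (\<lambda>_. site_measure J) \<rightarrow>\<^sub>M borel"
    by (cases "i \<in> lattice_box N") (auto intro!: measurable_component_singleton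
        simp: measurable_cong_sets[OF refl sets_site_measure[symmetric, of J]])
qed auto

lemma finite_interacting_pairs: "finite {(i, j). nbr i j \<and> (i \<in> lattice_box N \<or> j \<in> lattice_box N)}"
proof (rule finite_subset)
  show "{(i, j). nbr i j \<and> (i \<in> lattice_box N \<or> j \<in> lattice_box N)} \<subseteq> lattice_box (Suc N) \<times> lattice_box (Suc N)"
    by (auto simp: nbr_def lattice_box_def)
qed (auto simp: lattice_box_def)

lemma sets_dry_set_eq: "{\<phi>. dry_set \<phi> = A} \<in> sets (pinned_measure N V J)"
proof -
  have "{\<phi> \<in> space (Pi\<^sub>M UNIV (\<lambda>_::site. borel :: real measure)).
      \<forall>i. (\<phi> i = 0) = (i \<in> A)} \<in> sets (Pi\<^sub>M UNIV (\<lambda>_. borel))"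
    by measurable
  moreover have "{\<phi> \<in> space (Pi\<^sub>M UNIV (\<lambda>_::site. borel :: real measure)).
      \<forall>i. (\<phi> i = 0) = (i \<in> A)} = {\<phi>. dry_set \<phi> = A}"
    by (auto simp: dry_set_def space_PiM)
  ultimately have "{\<phi>. dry_set \<phi> = A} \<in> sets (Pi\<^sub>M UNIV (\<lambda>_. borel))"
    by (simp only:)
  then show ?thesis
    by (simp add: pinned_measure_def reference_measure_def)
qed

lemma finite_supersets_compl_box: "finite {A. - lattice_box N \<subseteq> A \<and> A \<inter> B = {}}"
proof (rule finite_subset)
  show "{A. - lattice_box N \<subseteq> A \<and> A \<inter> B = {}} \<subseteq> (\<lambda>C. - lattice_box N \<union> C) ` Pow (lattice_box N)"
  proof
    fix A assume "A \<in> {A. - lattice_box N \<subseteq> A \<and> A \<inter> B = {}}"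
    then have "A = - lattice_box N \<union> (A \<inter> lattice_box N)" by auto
    then show "A \<in> (\<lambda>C. - lattice_box N \<union> C) ` Pow (lattice_box N)" by blast
  qed
qed (simp add: lattice_box_def)

lemma measurable_hamiltonian:
  assumes "interaction_potential c V"
  shows "hamiltonian N V \<in> borel_measurable (Pi\<^sub>M UNIV (\<lambda>_. borel))"
proof -
  have "(deriv ^^ 0) V differentiable_on UNIV"
    using assms unfolding interaction_potential_def by blast
  then have "continuous_on UNIV V"
    by (simp add: differentiable_imp_continuous_on)
  then have [measurable]: "V \<in> borel_measurable borel"
    by (rule borel_measurable_continuous_onI)
  show ?thesis
    unfolding hamiltonian_def[abs_def] case_prod_beta by measurable
qed

lemma dry_law_eq_0:
  assumes V: "interaction_potential c V" and "\<not> - lattice_box N \<subseteq> A"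
  shows "dry_law N V J A = 0"
proof -
  have ev: "{\<phi>. dry_set \<phi> = A} \<in> sets (Pi\<^sub>M UNIV (\<lambda>_. borel))"
    using sets_dry_set_eq[of A N V J] by (simp add: pinned_measure_def reference_measure_def)
  have "emeasure (reference_measure N J) {\<phi>. dry_set \<phi> = A} = emeasure
      (Pi\<^sub>M (lattice_box N) (\<lambda>_. site_measure J))
      ((\<lambda>\<phi> i. if i \<in> lattice_box N then \<phi> i else 0) -` {\<phi>. dry_set \<phi> = A} \<inter>
        space (Pi\<^sub>M (lattice_box N) (\<lambda>_. site_measure J)))"
    unfolding reference_measure_def
    by (rule emeasure_distr[OF measurable_zero_extension ev])
  also have "(\<lambda>\<phi> i. if i \<in> lattice_box N then \<phi> i else 0) -` {\<phi>. dry_set \<phi> = A} = {}"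
    using assms(2) by (auto simp: dry_set_def split: if_splits)
  finally have null: "{\<phi>. dry_set \<phi> = A} \<in> null_sets (reference_measure N J)"
    using ev by (auto simp: reference_measure_def)
  note [measurable] = measurable_hamiltonian[OF V]
  have "hamiltonian N V \<in> borel_measurable (reference_measure N J)"
    by (simp add: reference_measure_def)
  then have meas: "(\<lambda>\<phi>. ennreal (exp (- hamiltonian N V \<phi>)) / partition_function N V J)
      \<in> borel_measurable (reference_measure N J)"
    by measurable
  have "{\<phi>. dry_set \<phi> = A} \<in> null_sets (pinned_measure N V J)"
    using null absolutely_continuousI_density[OF meas]
    by (auto simp: pinned_measure_def absolutely_continuous_def)
  then show ?thesis
    by (simp add: dry_law_def measure_def null_setsD1)
qed

end

theory Submission
  imports Defs
begin

text \<open>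
  The idea is energy against entropy. Pinning one more site \<open>x\<close>, at lattice distance at most \<open>L\<close>
  from the dry set, multiplies the probability of the dry pattern by at least a constant times
  \<open>1 / sqrt L\<close> (lemma \<open>dry_law_insert\<close>), because the height at \<open>x\<close> then has a density that is
  dominated by a centred Gaussian profile of variance of order \<open>L\<close>. A connected set of diameter at
  least \<open>K\<close> offers at least \<open>K\<close> sites to pin within distance \<open>K\<close> of any of its points, so opening
  the choice of one site per block of scale \<open>K\<close> gains a factor of order \<open>K / sqrt K\<close>. This is large
  when \<open>K\<close> is large, however small \<open>exp J\<close> is.

  The Gaussian bound is \<open>dry_partition_insert\<close>. Let \<open>g s\<close> be the partition function with the
  height at \<open>x\<close> set to \<open>s\<close>. The Hamiltonian is uniformly convex, and the average of a configuration
  with height \<open>s\<close> at \<open>x\<close> and one with height \<open>- s\<close> vanishes at \<open>x\<close>. Their half-difference climbs from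
  \<open>0\<close> on the dry set to \<open>s\<close> at \<open>x\<close>, so by Cauchy--Schwarz along a path its Dirichlet energy
  is at least of order \<open>s\<^sup>2 / L\<close>. The Prekopa--Leindler inequality turns this pointwise statement into
  \<open>g s * g (- s) \<le> (exp (- s\<^sup>2 / (4 * c * L)) * g 0)\<^sup>2\<close>, and by evenness \<open>g s = g (- s)\<close>. Integrating
  over \<open>s\<close> compares the partition functions without and with the pin at \<open>x\<close>.

  For the combinatorics, let \<open>T\<close> be a set disjoint from the dry set \<open>D\<close> and connected to it through
  \<open>T\<close> (\<open>attached\<close>). Blocks around the points of a maximal separated subset of \<open>T\<close> can be pinned one
  after the other, each time close to a block that is already pinned or to \<open>D\<close>. This gives
  \<open>exp (w * card T) * P(dry set = D) \<le> (\<Sum>C\<subseteq>T. P(dry set = D \<union> C))\<close> for a constant \<open>w > 0\<close>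
  depending on \<open>K\<close> only (\<open>attached_pinning_gain\<close>), and since \<open>D\<close> and \<open>C\<close> can be read off from \<open>D \<union> C\<close>, summing over \<open>D\<close>
  bounds the probability of all these \<open>D\<close> together by \<open>exp (- w * card T)\<close>
  (\<open>attached_family_bound\<close>).

  The set \<open>B\<close> itself may be far from the dry set, and then the first pin costs a factor that is not
  uniform in \<open>N\<close>. It is therefore enlarged: from the rightmost site of each component a
  horizontal ray runs to the right until it meets the dry set or another component. The enlarged set
  is attached, and the probability that the rays have prescribed lengths decays exponentially
  in their total length as well. So summing over the lengths costs only a constant factor per
  component, which the factor \<open>exp (- \<nu> * card B)\<close> absorbs as soon as every component has
  diameter at least \<open>R\<close>.
\<close>


section \<open>The Prekopa--Leindler inequality\<close>

text \<open>
  The translates of \<open>K\<close> by the minimum of \<open>L\<close> and of \<open>L\<close> by the maximum of \<open>K\<close> both lie in \<open>2 C\<close> and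
  meet in at most one point.
\<close>

lemma brunn_minkowski_real_compact:
  fixes K L C :: "real set"
  assumes K: "compact K" "K \<noteq> {}" and L: "compact L" "L \<noteq> {}" and C: "C \<in> sets borel"
    and mid: "\<And>x y. x \<in> K \<Longrightarrow> y \<in> L \<Longrightarrow> (x + y) / 2 \<in> C"
  shows "emeasure lborel K + emeasure lborel L \<le> 2 * emeasure lborel C"
proof -
  obtain a where a: "a \<in> K" "\<And>x. x \<in> K \<Longrightarrow> x \<le> a"
    using compact_attains_sup[OF K] by blast
  obtain b where b: "b \<in> L" "\<And>y. y \<in> L \<Longrightarrow> b \<le> y"
    using compact_attains_inf[OF L] by blast
  have [measurable]: "K \<in> sets borel" "L \<in> sets borel" "C \<in> sets borel"
    using K L C by (auto intro: borel_closed compact_imp_closed)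
  have ind: "indicator K (2 * z - b) + indicator L (2 * z - a) \<le> (indicator C z :: ennreal)"
    if "z \<noteq> (a + b) / 2" for z
  proof -
    have "2 * z - b \<in> K \<Longrightarrow> z \<in> C" "2 * z - a \<in> L \<Longrightarrow> z \<in> C"
      using mid[of "2 * z - b" b] mid[of a "2 * z - a"] a b by auto
    moreover have "\<not> (2 * z - b \<in> K \<and> 2 * z - a \<in> L)"
      using a(2)[of "2 * z - b"] b(2)[of "2 * z - a"] that by (auto simp: field_simps)
    ultimately show ?thesis by (auto simp: indicator_def)
  qed
  have scale: "emeasure lborel S = 2 * (\<integral>\<^sup>+z. indicator S (2 * z - t) \<partial>lborel)"
    if "S \<in> sets borel" for S :: "real set" and t
    using nn_integral_real_affine[of "indicator S" 2 "- t"] that by (simp add: algebra_simps)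
  have "emeasure lborel K + emeasure lborel L
      = 2 * (\<integral>\<^sup>+z. indicator K (2 * z - b) + indicator L (2 * z - a) \<partial>lborel)"
    by (subst scale[of K b], simp, subst scale[of L a], simp, subst nn_integral_add)
       (auto simp: distrib_left)
  also have "(\<integral>\<^sup>+z. indicator K (2 * z - b) + indicator L (2 * z - a) \<partial>lborel)
      \<le> (\<integral>\<^sup>+z. indicator C z \<partial>lborel)"
    by (rule nn_integral_mono_AE, rule AE_mp[OF AE_lborel_singleton[of "(a + b) / 2"]])
       (use ind in auto)
  finally show ?thesis
    by (simp add: mult_left_mono)
qed

text \<open>
  Inner approximation by compact sets, on bounded pieces. This keeps the Minkowski sum itself out of
  the statement, which need not be a Borel set.
\<close>

lemma brunn_minkowski_real:
  fixes A B C :: "real set"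
  assumes [measurable]: "A \<in> sets borel" "B \<in> sets borel" "C \<in> sets borel"
    and ne: "A \<noteq> {}" "B \<noteq> {}"
    and mid: "\<And>x y. x \<in> A \<Longrightarrow> y \<in> B \<Longrightarrow> (x + y) / 2 \<in> C"
  shows "emeasure lborel A + emeasure lborel B \<le> 2 * emeasure lborel C"
proof -
  have inner: "\<exists>K. compact K \<and> K \<noteq> {} \<and> K \<subseteq> S \<and> emeasure lborel S \<le> emeasure lborel K + ennreal e"
    if S: "S \<in> sets borel" "S \<noteq> {}" "S \<subseteq> {-m..m}" and "e > 0" for S :: "real set" and m e
  proof -
    obtain T where T: "closed T" "T \<subseteq> S" "S - T \<in> lmeasurable"
        "emeasure lebesgue (S - T) < ennreal e"
      using sets_lebesgue_inner_closed[of S e] S \<open>e > 0\<close> by (auto simp: sets_completionI_sets)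
    obtain s where s: "s \<in> S" using S by auto
    let ?K = "insert s T"
    have "compact T"
      using T S compact_Icc[of "-m" m] closed_Int_compact[of T "{-m..m}"] by (simp add: Int_absorb2)
    then have "compact ?K" by simp
    moreover have "emeasure lborel S \<le> emeasure lborel ?K + ennreal e"
    proof -
      have m: "T \<in> sets borel" "?K \<in> sets borel" using T(1) by auto
      have "emeasure lborel S \<le> emeasure lborel (?K \<union> (S - T))"
        by (rule emeasure_mono) (use S m in auto)
      also have "\<dots> \<le> emeasure lborel ?K + emeasure lborel (S - T)"
        by (rule emeasure_subadditive) (use S m in auto)
      also have "emeasure lborel (S - T) = emeasure lebesgue (S - T)"
        using S m by simp
      finally show ?thesis
        using T(4) by (meson add_left_mono le_less_trans less_imp_le order_trans)
    qed
    ultimately show ?thesis using T s by (intro exI[of _ ?K]) auto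
  qed
  have bounded: "emeasure lborel S + emeasure lborel S' \<le> 2 * emeasure lborel C"
    if S: "S \<in> sets borel" "S \<noteq> {}" "S \<subseteq> {-m..m}" "S \<subseteq> A"
    and S': "S' \<in> sets borel" "S' \<noteq> {}" "S' \<subseteq> {-m..m}" "S' \<subseteq> B" for S S' :: "real set" and m
  proof (rule ennreal_le_epsilon)
    fix e :: real assume "0 < e"
    then obtain K L where K: "compact K" "K \<noteq> {}" "K \<subseteq> S" "emeasure lborel S \<le> emeasure lborel K + ennreal (e/2)"
      and L: "compact L" "L \<noteq> {}" "L \<subseteq> S'" "emeasure lborel S' \<le> emeasure lborel L + ennreal (e/2)"
      using inner[OF S(1-3), of "e/2"] inner[OF S'(1-3), of "e/2"] by auto
    have "emeasure lborel S + emeasure lborel S'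
        \<le> (emeasure lborel K + ennreal (e/2)) + (emeasure lborel L + ennreal (e/2))"
      using K L by (intro add_mono)
    also have "\<dots> = (emeasure lborel K + emeasure lborel L) + (ennreal (e/2) + ennreal (e/2))"
      by (simp add: algebra_simps)
    also have "ennreal (e/2) + ennreal (e/2) = ennreal e"
      using \<open>0 < e\<close> by (simp flip: ennreal_plus)
    also have "emeasure lborel K + emeasure lborel L \<le> 2 * emeasure lborel C"
      using K L S S' by (intro brunn_minkowski_real_compact mid) auto
    finally show "emeasure lborel S + emeasure lborel S' \<le> 2 * emeasure lborel C + ennreal e"
      by simp
  qed
  have lim: "(\<lambda>n::nat. emeasure lborel (S \<inter> {- real n..real n})) \<longlonglongrightarrow> emeasure lborel S"
    if "S \<in> sets borel" for S :: "real set"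
  proof -
    have "(\<Union>n::nat. S \<inter> {- real n..real n}) = S"
    proof safe
      fix x assume "x \<in> S"
      obtain n :: nat where "\<bar>x\<bar> \<le> real n" using real_arch_simple by blast
      then show "x \<in> (\<Union>n::nat. S \<inter> {- real n..real n})" using \<open>x \<in> S\<close> by (auto intro!: exI[of _ n])
    qed
    moreover have "(\<lambda>n::nat. emeasure lborel (S \<inter> {- real n..real n}))
        \<longlonglongrightarrow> emeasure lborel (\<Union>n::nat. S \<inter> {- real n..real n})"
      using that by (intro Lim_emeasure_incseq) (auto simp: incseq_def)
    ultimately show ?thesis by simp
  qed
  obtain x y where xy: "x \<in> A" "y \<in> B" using ne by auto
  obtain n0 :: nat where n0: "max \<bar>x\<bar> \<bar>y\<bar> \<le> real n0" using real_arch_simple by blast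
  show ?thesis
  proof (rule tendsto_upperbound[OF tendsto_add[OF lim lim]])
    show "\<forall>\<^sub>F n in sequentially. emeasure lborel (A \<inter> {- real n..real n}) +
        emeasure lborel (B \<inter> {- real n..real n}) \<le> 2 * emeasure lborel C"
      unfolding eventually_sequentially
    proof (intro exI allI impI)
      fix n assume "n0 \<le> n"
      then have "real n0 \<le> real n" by simp
      then have "x \<in> A \<inter> {- real n..real n}" "y \<in> B \<inter> {- real n..real n}"
        using xy n0 by auto
      then show "emeasure lborel (A \<inter> {- real n..real n}) +
        emeasure lborel (B \<inter> {- real n..real n}) \<le> 2 * emeasure lborel C"
        by (intro bounded[of _ "real n"]) auto
    qed
  qed auto
qed

text \<open>
  The layer-cake formula, truncated at height 1, where the levels are real numbers.
\<close>

lemma nn_integral_superlevel: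
  fixes f :: "real \<Rightarrow> ennreal"
  assumes [measurable]: "f \<in> borel_measurable borel"
  shows "(\<integral>\<^sup>+x. min (f x) 1 \<partial>lborel) =
    (\<integral>\<^sup>+t. indicator {0<..<1} t * emeasure lborel {x. ennreal t < f x} \<partial>lborel)"
proof -
  have "(\<integral>\<^sup>+x. min (f x) 1 \<partial>lborel) =
      (\<integral>\<^sup>+x. \<integral>\<^sup>+t. indicator {0<..<1} t * indicator {x. ennreal t < f x} x \<partial>lborel \<partial>lborel)"
  proof (rule nn_integral_cong)
    fix x :: real
    have "min (f x) 1 \<noteq> \<top>"
      by (metis ennreal_one_neq_top min.cobounded2 neq_top_trans)
    then obtain r where r: "min (f x) 1 = ennreal r" "0 \<le> r"
      by (metis ennreal_cases)
    then have "r \<le> 1"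
      by (metis ennreal_le_1 min.cobounded2)
    note r = r this
    have "(\<integral>\<^sup>+t. indicator {0<..<1} t * indicator {x. ennreal t < f x} x \<partial>lborel)
        = (\<integral>\<^sup>+t. indicator {0<..<r} t \<partial>lborel)"
    proof (rule nn_integral_cong)
      fix t :: real
      have "ennreal t < f x \<longleftrightarrow> t < r" if "0 < t" "t < 1"
      proof -
        have "ennreal t < f x \<longleftrightarrow> ennreal t < min (f x) 1" using that by (simp add: ennreal_less_one_iff)
        then show ?thesis using r that by (simp add: ennreal_less_iff)
      qed
      then show "indicator {0<..<1} t * indicator {x. ennreal t < f x} x = (indicator {0<..<r} t :: ennreal)"
        using r by (auto simp: indicator_def)
    qed
    then show "min (f x) 1 = (\<integral>\<^sup>+t. indicator {0<..<1} t * indicator {x. ennreal t < f x} x \<partial>lborel)"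
      using r by simp
  qed
  also have "\<dots> = (\<integral>\<^sup>+t. \<integral>\<^sup>+x. indicator {0<..<1} t * indicator {x. ennreal t < f x} x \<partial>lborel \<partial>lborel)"
    by (rule lborel_pair.Fubini') measurable
  also have "\<dots> = (\<integral>\<^sup>+t. indicator {0<..<1} t * emeasure lborel {x. ennreal t < f x} \<partial>lborel)"
    by (subst nn_integral_cmult) auto
  finally show ?thesis .
qed

lemma ennreal_am_gm: "a * b \<le> c\<^sup>2" if "a + b \<le> 2 * c" for a b c :: ennreal
proof (cases c)
  case (real r)
  then have "a \<noteq> \<top>" "b \<noteq> \<top>" using that by (auto simp: top_unique ennreal_mult_eq_top_iff)
  then obtain a' b' where ab: "a = ennreal a'" "0 \<le> a'" "b = ennreal b'" "0 \<le> b'"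
    by (metis ennreal_cases)
  have "a' + b' \<le> 2 * r"
    using that real ab by (simp flip: ennreal_plus ennreal_numeral ennreal_mult)
  moreover have "4 * (a' * b') \<le> (a' + b')\<^sup>2"
    using zero_le_power2[of "a' - b'"] by (simp add: power2_eq_square algebra_simps)
  moreover have "(a' + b')\<^sup>2 \<le> (2 * r)\<^sup>2"
    using calculation ab by (intro power_mono) auto
  ultimately have "a' * b' \<le> r\<^sup>2" by (simp add: power_mult_distrib)
  then show ?thesis using real ab by (simp add: ennreal_power flip: ennreal_mult)
next
  case top
  then show ?thesis by (simp add: power2_eq_square)
qed

text \<open>
  Equal suprema make the superlevel sets of \<open>f\<close> and \<open>g\<close> nonempty for the same range of levels,
  so the one-dimensional Brunn--Minkowski inequality applies level by level. The result is an
  arithmetic mean, hence stronger than the geometric one.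
\<close>

lemma prekopa_leindler_normalised:
  fixes f g h :: "real \<Rightarrow> ennreal"
  assumes [measurable]: "f \<in> borel_measurable borel" "g \<in> borel_measurable borel"
      "h \<in> borel_measurable borel"
    and mid: "\<And>x y. f x * g y \<le> (h ((x + y) / 2))\<^sup>2"
    and f: "(SUP x. f x) = 1" and g: "(SUP x. g x) = 1"
  shows "(\<integral>\<^sup>+x. f x \<partial>lborel) + (\<integral>\<^sup>+x. g x \<partial>lborel) \<le> 2 * (\<integral>\<^sup>+x. h x \<partial>lborel)"
proof -
  have le1: "f x \<le> 1" "g x \<le> 1" for x
    using f g by (metis SUP_upper UNIV_I)+
  have level: "emeasure lborel {x. ennreal t < f x} + emeasure lborel {x. ennreal t < g x}
      \<le> 2 * emeasure lborel {x. ennreal t < h x}" if "0 < t" "t < 1" for t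
  proof (rule brunn_minkowski_real)
    have "ennreal t < 1" using that by (simp add: ennreal_less_one_iff)
    then show "{x. ennreal t < f x} \<noteq> {}" "{x. ennreal t < g x} \<noteq> {}"
      using f g less_SUP_iff[of "ennreal t" f UNIV] less_SUP_iff[of "ennreal t" g UNIV] by auto
    fix x y assume xy: "x \<in> {x. ennreal t < f x}" "y \<in> {x. ennreal t < g x}"
    obtain a b where ab: "f x = ennreal a" "0 \<le> a" "g y = ennreal b" "0 \<le> b"
      using le1 by (metis ennreal_cases ennreal_one_neq_top neq_top_trans)
    then have "t * t < a * b"
      using xy that by (intro mult_strict_mono) (auto simp: ennreal_less_iff)
    then have "(ennreal t)\<^sup>2 < f x * g y"
      using ab that by (simp add: power2_eq_square ennreal_less_iff flip: ennreal_mult)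
    then have "(ennreal t)\<^sup>2 < (h ((x + y) / 2))\<^sup>2"
      using mid[of x y] by (rule less_le_trans)
    then show "(x + y) / 2 \<in> {x. ennreal t < h x}"
      by (metis mem_Collect_eq not_le power_mono zero_le)
  qed measurable
  have "(\<integral>\<^sup>+x. f x \<partial>lborel) + (\<integral>\<^sup>+x. g x \<partial>lborel) =
      (\<integral>\<^sup>+x. min (f x) 1 \<partial>lborel) + (\<integral>\<^sup>+x. min (g x) 1 \<partial>lborel)"
    using le1 by (simp add: min_absorb1)
  also have "\<dots> = (\<integral>\<^sup>+t. indicator {0<..<1} t * emeasure lborel {x. ennreal t < f x}
      + indicator {0<..<1} t * emeasure lborel {x. ennreal t < g x} \<partial>lborel)"
    unfolding nn_integral_superlevel[OF assms(1)] nn_integral_superlevel[OF assms(2)]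
    by (rule nn_integral_add[symmetric]) measurable
  also have "\<dots> \<le> (\<integral>\<^sup>+t. 2 * (indicator {0<..<1} t * emeasure lborel {x. ennreal t < h x}) \<partial>lborel)"
    using level by (intro nn_integral_mono) (auto simp: indicator_def)
  also have "\<dots> = 2 * (\<integral>\<^sup>+x. min (h x) 1 \<partial>lborel)"
    unfolding nn_integral_superlevel[OF assms(3)] by (rule nn_integral_cmult) measurable
  also have "\<dots> \<le> 2 * (\<integral>\<^sup>+x. h x \<partial>lborel)"
    by (intro mult_left_mono nn_integral_mono) auto
  finally show ?thesis .
qed

lemma prekopa_leindler_bounded:
  fixes f g h :: "real \<Rightarrow> ennreal"
  assumes [measurable]: "f \<in> borel_measurable borel" "g \<in> borel_measurable borel"
      "h \<in> borel_measurable borel"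
    and mid: "\<And>x y. f x * g y \<le> (h ((x + y) / 2))\<^sup>2"
    and f: "(SUP x. f x) \<noteq> \<top>" and g: "(SUP x. g x) \<noteq> \<top>"
  shows "(\<integral>\<^sup>+x. f x \<partial>lborel) * (\<integral>\<^sup>+x. g x \<partial>lborel) \<le> (\<integral>\<^sup>+x. h x \<partial>lborel)\<^sup>2"
proof (cases "(SUP x. f x) = 0 \<or> (SUP x. g x) = 0")
  case True
  then have "(\<forall>x. f x = 0) \<or> (\<forall>x. g x = 0)"
    by (metis SUP_upper UNIV_I le_zero_eq)
  then show ?thesis by auto
next
  case False
  then obtain F G where F: "(SUP x. f x) = ennreal F" "0 < F" and G: "(SUP x. g x) = ennreal G" "0 < G"
    using f g by (metis ennreal_cases ennreal_0 order_less_le)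
  define s where "s = sqrt (F * G)"
  have s: "0 < s" "s\<^sup>2 = F * G" using F G by (auto simp: s_def)
  let ?a = "ennreal (1 / F)" and ?b = "ennreal (1 / G)" and ?c = "ennreal (1 / s)"
  have c2: "?c\<^sup>2 = ?a * ?b"
    using F G s by (simp add: ennreal_power power_divide flip: ennreal_mult)
  have "(\<integral>\<^sup>+x. ?a * f x \<partial>lborel) + (\<integral>\<^sup>+x. ?b * g x \<partial>lborel) \<le> 2 * (\<integral>\<^sup>+x. ?c * h x \<partial>lborel)"
  proof (rule prekopa_leindler_normalised)
    show "?a * f x * (?b * g y) \<le> (?c * h ((x + y) / 2))\<^sup>2" for x y
      using mult_left_mono[OF mid[of x y], of "?a * ?b"]
      by (simp add: power_mult_distrib c2 ac_simps)
    show "(SUP x. ?a * f x) = 1" "(SUP x. ?b * g x) = 1"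
      using F G by (simp_all add: SUP_mult_left_ennreal[symmetric] flip: ennreal_mult)
  qed measurable
  then have "(\<integral>\<^sup>+x. ?a * f x \<partial>lborel) * (\<integral>\<^sup>+x. ?b * g x \<partial>lborel) \<le> (\<integral>\<^sup>+x. ?c * h x \<partial>lborel)\<^sup>2"
    by (rule ennreal_am_gm)
  then have *: "(?a * ?b) * ((\<integral>\<^sup>+x. f x \<partial>lborel) * (\<integral>\<^sup>+x. g x \<partial>lborel)) \<le> (?a * ?b) * (\<integral>\<^sup>+x. h x \<partial>lborel)\<^sup>2"
    by (simp add: nn_integral_cmult power_mult_distrib c2) (simp add: ac_simps)
  have "ennreal (F * G) * (?a * ?b) = 1"
    using F G by (simp flip: ennreal_mult)
  then show ?thesis
    using mult_left_mono[OF *, of "ennreal (F * G)"] by (simp flip: mult.assoc)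
qed

text \<open>
  Prekopa--Leindler for midpoints on the line. Truncating \<open>f\<close> and \<open>g\<close> reduces it to bounded functions,
  for which the suprema can be normalised.
\<close>

lemma prekopa_leindler_real:
  fixes f g h :: "real \<Rightarrow> ennreal"
  assumes [measurable]: "f \<in> borel_measurable borel" "g \<in> borel_measurable borel"
      "h \<in> borel_measurable borel"
    and mid: "\<And>x y. f x * g y \<le> (h ((x + y) / 2))\<^sup>2"
  shows "(\<integral>\<^sup>+x. f x \<partial>lborel) * (\<integral>\<^sup>+x. g x \<partial>lborel) \<le> (\<integral>\<^sup>+x. h x \<partial>lborel)\<^sup>2"
proof -
  have trunc: "(SUP n::nat. \<integral>\<^sup>+x. min (u x) (of_nat n) \<partial>lborel) = (\<integral>\<^sup>+x. u x \<partial>lborel)"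
    if [measurable]: "u \<in> borel_measurable borel" for u :: "real \<Rightarrow> ennreal"
  proof -
    have "(SUP n::nat. min (u x) (of_nat n)) = u x" for x
      using inf_SUP[of "u x" "\<lambda>n. of_nat n" "UNIV::nat set"] by (simp add: inf_min ennreal_SUP_of_nat_eq_top)
    then have "(\<integral>\<^sup>+x. u x \<partial>lborel) = (\<integral>\<^sup>+x. (SUP n::nat. min (u x) (of_nat n)) \<partial>lborel)"
      by simp
    also have "\<dots> = (SUP n::nat. \<integral>\<^sup>+x. min (u x) (of_nat n) \<partial>lborel)"
      by (rule nn_integral_monotone_convergence_SUP)
         (auto simp: incseq_def le_fun_def min_def intro: order_trans)
    finally show ?thesis by simp
  qed
  have bound: "(\<integral>\<^sup>+x. min (f x) (of_nat n) \<partial>lborel) * (\<integral>\<^sup>+x. min (g x) (of_nat m) \<partial>lborel)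
      \<le> (\<integral>\<^sup>+x. h x \<partial>lborel)\<^sup>2" for n m :: nat
  proof (rule prekopa_leindler_bounded)
    show "min (f x) (of_nat n) * min (g y) (of_nat m) \<le> (h ((x + y) / 2))\<^sup>2" for x y
      by (rule order_trans[OF _ mid[of x y]]) (auto intro!: mult_mono)
    have "(SUP x. min (u x) (of_nat n)) \<le> of_nat n" for u :: "real \<Rightarrow> ennreal" and n :: nat
      by (rule SUP_least) simp
    then show "(SUP x. min (f x) (of_nat n)) \<noteq> \<top>" "(SUP x. min (g x) (of_nat m)) \<noteq> \<top>"
      by (metis ennreal_of_nat_neq_top neq_top_trans)+
  qed measurable
  show ?thesis
    unfolding trunc[OF assms(1), symmetric] trunc[OF assms(2), symmetric]
    by (simp add: SUP_mult_right_ennreal SUP_mult_left_ennreal bound SUP_least)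
qed

text \<open>
  The inequality tensorises: by the one-dimensional case, integrating out one coordinate preserves the
  hypothesis. Functions with values in \<open>ennreal\<close> are needed here since the partial integrals
  may be infinite.
\<close>

lemma prekopa_leindler_PiM:
  fixes f g h :: "('i \<Rightarrow> real) \<Rightarrow> ennreal"
  assumes "finite I"
    and "f \<in> borel_measurable (Pi\<^sub>M I (\<lambda>_. lborel))" "g \<in> borel_measurable (Pi\<^sub>M I (\<lambda>_. lborel))"
      "h \<in> borel_measurable (Pi\<^sub>M I (\<lambda>_. lborel))"
    and "\<And>x y. x \<in> extensional I \<Longrightarrow> y \<in> extensional I \<Longrightarrow>
      f x * g y \<le> (h (\<lambda>i. (x i + y i) / 2))\<^sup>2"
  shows "(\<integral>\<^sup>+x. f x \<partial>Pi\<^sub>M I (\<lambda>_. lborel)) * (\<integral>\<^sup>+x. g x \<partial>Pi\<^sub>M I (\<lambda>_. lborel))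
    \<le> (\<integral>\<^sup>+x. h x \<partial>Pi\<^sub>M I (\<lambda>_. lborel))\<^sup>2"
proof -
  interpret product_sigma_finite "\<lambda>_::'i. lborel :: real measure" by standard
  show ?thesis
    using assms
  proof (induction I arbitrary: f g h rule: finite_induct)
    case empty
    have "(\<lambda>i::'i. (undefined + undefined) / 2) = (\<lambda>_. undefined :: real)" by simp
    then show ?case
      using empty(4)[of "\<lambda>_. undefined" "\<lambda>_. undefined"] by (simp add: nn_integral_empty)
  next
    case (insert j I)
    note meas = insert.prems(1-3)
    note [measurable] = meas
    have "(\<integral>\<^sup>+x. (\<integral>\<^sup>+t. f (x(j := t)) \<partial>lborel) \<partial>Pi\<^sub>M I (\<lambda>_. lborel)) *
        (\<integral>\<^sup>+x. (\<integral>\<^sup>+t. g (x(j := t)) \<partial>lborel) \<partial>Pi\<^sub>M I (\<lambda>_. lborel))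
        \<le> (\<integral>\<^sup>+x. (\<integral>\<^sup>+t. h (x(j := t)) \<partial>lborel) \<partial>Pi\<^sub>M I (\<lambda>_. lborel))\<^sup>2"
    proof (rule insert.IH)
      fix x y :: "'i \<Rightarrow> real" assume xy: "x \<in> extensional I" "y \<in> extensional I"
      then have mid: "(\<lambda>i. (x i + y i) / 2) \<in> extensional I"
        by (auto simp: extensional_def)
      have section_meas: "(\<lambda>t. u (z(j := t))) \<in> borel_measurable borel"
        if u: "u \<in> borel_measurable (Pi\<^sub>M (insert j I) (\<lambda>_. lborel))" and z: "z \<in> extensional I"
        for u :: "('i \<Rightarrow> real) \<Rightarrow> ennreal" and z
      proof -
        have "(\<lambda>t. z(j := t)) \<in> lborel \<rightarrow>\<^sub>M Pi\<^sub>M (insert j I) (\<lambda>_. lborel)"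
          using z insert.hyps(2)
          by (intro measurable_PiM_single') (auto simp: extensional_def PiE_def)
        from measurable_compose[OF this u] show ?thesis by simp
      qed
      show "(\<integral>\<^sup>+t. f (x(j := t)) \<partial>lborel) * (\<integral>\<^sup>+t. g (y(j := t)) \<partial>lborel)
          \<le> (\<integral>\<^sup>+t. h ((\<lambda>i. (x i + y i) / 2)(j := t)) \<partial>lborel)\<^sup>2"
      proof (rule prekopa_leindler_real)
        fix s t :: real
        have "x(j := s) \<in> extensional (insert j I)" "y(j := t) \<in> extensional (insert j I)"
          using xy by (auto simp: extensional_def)
        then have "f (x(j := s)) * g (y(j := t)) \<le> (h (\<lambda>i. ((x(j := s)) i + (y(j := t)) i) / 2))\<^sup>2"
          by (rule insert.prems(4))
        also have "(\<lambda>i. ((x(j := s)) i + (y(j := t)) i) / 2) = (\<lambda>i. (x i + y i) / 2)(j := (s + t) / 2)"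
          by auto
        finally show "f (x(j := s)) * g (y(j := t)) \<le> (h ((\<lambda>i. (x i + y i) / 2)(j := (s + t) / 2)))\<^sup>2" .
      qed (use section_meas meas xy mid in auto)
    qed measurable
    then show ?case
      using insert.hyps meas by (simp add: product_nn_integral_insert)
  qed
qed

section \<open>Uniform convexity of the Hamiltonian\<close>

definition zero_extension :: "'i set \<Rightarrow> ('i \<Rightarrow> real) \<Rightarrow> 'i \<Rightarrow> real" where
  "zero_extension S \<psi> = (\<lambda>i. if i \<in> S then \<psi> i else 0)"

text \<open>
  Bonds are ordered pairs, so that every nearest-neighbour bond occurs twice, as in the Hamiltonian.
\<close>

definition bonds :: "nat \<Rightarrow> (site \<times> site) set" where
  "bonds N = {(i, j). nbr i j \<and> (i \<in> lattice_box N \<or> j \<in> lattice_box N)}"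

definition ldist :: "site \<Rightarrow> site \<Rightarrow> nat" where
  "ldist i j = nat (\<bar>fst i - fst j\<bar> + \<bar>snd i - snd j\<bar>)"

text \<open>
  The partition function with zero heights on \<open>A\<close> and Lebesgue measure on the other sites, that is, the
  weight of the dry set \<open>A\<close> without the factor \<open>exp J\<close> per pinned site.
\<close>

definition dry_partition :: "nat \<Rightarrow> (real \<Rightarrow> real) \<Rightarrow> site set \<Rightarrow> ennreal" where
  "dry_partition N V A = (\<integral>\<^sup>+\<psi>. ennreal (exp (- hamiltonian N V (zero_extension (lattice_box N - A) \<psi>)))
     \<partial>Pi\<^sub>M (lattice_box N - A) (\<lambda>_. lborel))"

lemma finite_bonds [simp]: "finite (bonds N)"
  using finite_interacting_pairs[of N] by (simp add: bonds_def)

lemma finite_lattice_box [simp]: "finite (lattice_box N)"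
  by (simp add: lattice_box_def)

lemma hamiltonian_bonds:
  "hamiltonian N V \<phi> = 1 / 2 * (\<Sum>e\<in>bonds N. V (\<phi> (fst e) - \<phi> (snd e)))"
  unfolding hamiltonian_def bonds_def by (simp add: case_prod_beta)

lemma nbr_ldist: "nbr i j \<longleftrightarrow> ldist i j = 1"
  by (auto simp: nbr_def ldist_def)

lemma exists_geodesic:
  "ldist x d = L \<Longrightarrow> \<exists>p. p 0 = x \<and> p L = d \<and> (\<forall>k<L. nbr (p k) (p (Suc k))) \<and>
    (\<forall>k\<le>L. ldist (p k) d = L - k)"
proof (induction L arbitrary: x)
  case 0
  then have "x = d" by (cases x; cases d) (auto simp: ldist_def)
  then show ?case using 0 by (intro exI[of _ "\<lambda>_. x"]) auto
next
  case (Suc L)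
  obtain x' where x': "nbr x x'" "ldist x' d = L"
  proof (cases "fst x = fst d")
    case True
    have "snd x \<noteq> snd d" using Suc.prems True by (auto simp: ldist_def)
    then show ?thesis
      using Suc.prems True
      by (intro that[of "(fst x, if snd x < snd d then snd x + 1 else snd x - 1)"])
         (auto simp: ldist_def nbr_def)
  next
    case False
    then show ?thesis
      using Suc.prems
      by (intro that[of "(if fst x < fst d then fst x + 1 else fst x - 1, snd x)"])
         (auto simp: ldist_def nbr_def)
  qed
  then obtain p where p: "p 0 = x'" "p L = d" "\<forall>k<L. nbr (p k) (p (Suc k))"
      "\<forall>k\<le>L. ldist (p k) d = L - k"
    using Suc.IH by blast
  let ?q = "case_nat x p"
  have "nbr (?q k) (?q (Suc k))" if "k < Suc L" for k
    using that p(1,3) x'(1) by (cases k) auto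
  moreover have "ldist (?q k) d = Suc L - k" if "k \<le> Suc L" for k
    using that p(4) Suc.prems by (cases k) auto
  ultimately show ?case
    using p(2) by (intro exI[of _ ?q]) auto
qed

text \<open>
  A unit resistor network bound: the effective resistance between two sites is at most their lattice
  distance. Sites on the geodesic have distinct distances from its end, so no bond is counted twice,
  and its steps with both ends outside the box carry no energy.
\<close>

lemma path_energy_bound:
  assumes out: "\<And>i. i \<notin> lattice_box N \<Longrightarrow> \<beta> i = 0" and d: "\<beta> d = 0" and L: "ldist x d \<le> L"
  shows "(\<beta> x)\<^sup>2 \<le> real L * (\<Sum>e\<in>bonds N. (\<beta> (fst e) - \<beta> (snd e))\<^sup>2)"
proof -
  define l where "l = ldist x d"
  obtain p where p: "p 0 = x" "p l = d" "\<And>k. k < l \<Longrightarrow> nbr (p k) (p (Suc k))"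
      "\<And>k. k \<le> l \<Longrightarrow> ldist (p k) d = l - k"
    using exists_geodesic[OF l_def[symmetric]] by blast
  let ?G = "\<lambda>e. (\<beta> (fst e) - \<beta> (snd e))\<^sup>2" and ?e = "\<lambda>k. (p k, p (Suc k))"
  have inj: "inj_on ?e {..<l}"
  proof (rule inj_onI)
    fix k m assume "k \<in> {..<l}" "m \<in> {..<l}" "?e k = ?e m"
    then show "k = m" using p(4)[of k] p(4)[of m] by auto
  qed
  have "\<beta> x = (\<Sum>k<l. \<beta> (p k) - \<beta> (p (Suc k)))"
    using sum_lessThan_telescope'[of "\<lambda>k. \<beta> (p k)" l] by (simp add: p(1,2) d)
  then have "(\<beta> x)\<^sup>2 \<le> real l * (\<Sum>k<l. (\<beta> (p k) - \<beta> (p (Suc k)))\<^sup>2)"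
    using sum_squared_le_sum_of_squares[of "\<lambda>k. \<beta> (p k) - \<beta> (p (Suc k))" "{..<l}"] by (simp add: mult.commute)
  also have "(\<Sum>k<l. (\<beta> (p k) - \<beta> (p (Suc k)))\<^sup>2) = (\<Sum>e\<in>?e ` {..<l}. ?G e)"
    by (subst sum.reindex[OF inj]) simp
  also have "\<dots> \<le> (\<Sum>e\<in>bonds N \<union> ?e ` {..<l}. ?G e)"
    by (rule sum_mono2) auto
  also have "\<dots> = (\<Sum>e\<in>bonds N. ?G e)"
  proof (rule sum.mono_neutral_right)
    show "\<forall>e\<in>bonds N \<union> ?e ` {..<l} - bonds N. ?G e = 0"
    proof
      fix e assume "e \<in> bonds N \<union> ?e ` {..<l} - bonds N"
      then obtain k where "k < l" "e = ?e k" "?e k \<notin> bonds N" by auto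
      then show "?G e = 0" using p(3)[of k] out[of "p k"] out[of "p (Suc k)"] by (simp add: bonds_def)
    qed
  qed auto
  also have "real l * \<dots> \<le> real L * \<dots>"
    using L by (intro mult_right_mono) (auto simp: l_def sum_nonneg)
  finally show ?thesis by (simp add: mult_left_mono)
qed

text \<open>
  Subtracting the quadratic \<open>t\<^sup>2 / (2 * c)\<close> leaves a convex function.
\<close>

lemma potential_midpoint:
  assumes V: "interaction_potential c V"
  shows "2 * V ((a + b) / 2) + ((a - b) / 2)\<^sup>2 / c \<le> V a + V b"
proof -
  have c: "c \<ge> 1" and d: "\<And>n. (deriv ^^ n) V differentiable_on UNIV"
    and lower: "\<And>t. 1 / c \<le> deriv (deriv V) t"
    using V by (auto simp: interaction_potential_def)
  have D0: "(V has_real_derivative deriv V t) (at t)" for t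
    using d[of 0] by (auto simp: differentiable_on_def DERIV_deriv_iff_real_differentiable)
  have D1: "(deriv V has_real_derivative deriv (deriv V) t) (at t)" for t
    using d[of 1] by (auto simp: differentiable_on_def DERIV_deriv_iff_real_differentiable)
  have "convex_on UNIV (\<lambda>t. V t - t\<^sup>2 / (2 * c))"
  proof (rule f''_ge0_imp_convex)
    show "((\<lambda>t. V t - t\<^sup>2 / (2 * c)) has_real_derivative (deriv V t - t / c)) (at t)" for t
    proof -
      have "((\<lambda>t. t\<^sup>2 / (2 * c)) has_real_derivative (t / c)) (at t)"
        using c by (auto intro!: derivative_eq_intros)
      then show ?thesis by (intro DERIV_diff D0)
    qed
    show "((\<lambda>t. deriv V t - t / c) has_real_derivative (deriv (deriv V) t - 1 / c)) (at t)" for t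
      using c by (auto intro!: derivative_eq_intros D1 simp: divide_simps)
  qed (use lower in auto)
  note convex = convex_onD[OF this, of "1/2" a b]
  define p q r where "p = a\<^sup>2 / (2 * c)" and "q = b\<^sup>2 / (2 * c)" and "r = ((a + b) / 2)\<^sup>2 / (2 * c)"
  have "V ((a + b) / 2) - r \<le> (V a - p) / 2 + (V b - q) / 2"
    using convex by (simp add: p_def q_def r_def add_divide_distrib)
  moreover have "((a - b) / 2)\<^sup>2 / c = p + q - 2 * r"
    using c by (simp add: p_def q_def r_def field_simps power2_eq_square)
  ultimately show ?thesis by argo
qed

text \<open>
  The quantitative convexity behind the Gaussian bound: the half-difference of \<open>\<phi>\<close> and \<open>\<psi>\<close> takes the
  value \<open>s\<close> at \<open>x\<close> and \<open>0\<close> at \<open>d\<close>, so its energy is at least \<open>s\<^sup>2 / L\<close>.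
\<close>

lemma hamiltonian_midpoint:
  assumes V: "interaction_potential c V"
    and out: "\<And>i. i \<notin> lattice_box N \<Longrightarrow> \<phi> i = 0 \<and> \<psi> i = 0"
    and d: "\<phi> d = 0" "\<psi> d = 0" and x: "\<phi> x = s" "\<psi> x = - s"
    and L: "ldist x d \<le> L" "0 < L"
  shows "2 * hamiltonian N V (\<lambda>i. (\<phi> i + \<psi> i) / 2) + s\<^sup>2 / (2 * c * real L)
    \<le> hamiltonian N V \<phi> + hamiltonian N V \<psi>"
proof -
  have c: "c \<ge> 1" using V by (simp add: interaction_potential_def)
  let ?\<beta> = "\<lambda>i. (\<phi> i - \<psi> i) / 2"
  have "(?\<beta> x)\<^sup>2 \<le> real L * (\<Sum>e\<in>bonds N. (?\<beta> (fst e) - ?\<beta> (snd e))\<^sup>2)"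
    by (rule path_energy_bound[OF _ _ L(1)]) (use out d in auto)
  then have E: "s\<^sup>2 / (2 * c * real L) \<le> (\<Sum>e\<in>bonds N. (?\<beta> (fst e) - ?\<beta> (snd e))\<^sup>2) / (2 * c)"
    using c L x by (simp add: field_simps)
  have "(\<Sum>e\<in>bonds N. 2 * V ((\<phi> (fst e) + \<psi> (fst e)) / 2 - (\<phi> (snd e) + \<psi> (snd e)) / 2)
          + (?\<beta> (fst e) - ?\<beta> (snd e))\<^sup>2 / c)
      \<le> (\<Sum>e\<in>bonds N. V (\<phi> (fst e) - \<phi> (snd e)) + V (\<psi> (fst e) - \<psi> (snd e)))"
  proof (rule sum_mono)
    fix e
    show "2 * V ((\<phi> (fst e) + \<psi> (fst e)) / 2 - (\<phi> (snd e) + \<psi> (snd e)) / 2)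
          + (?\<beta> (fst e) - ?\<beta> (snd e))\<^sup>2 / c \<le> V (\<phi> (fst e) - \<phi> (snd e)) + V (\<psi> (fst e) - \<psi> (snd e))"
      using potential_midpoint[OF V, of "\<phi> (fst e) - \<phi> (snd e)" "\<psi> (fst e) - \<psi> (snd e)"]
      by (simp add: diff_divide_distrib add_divide_distrib algebra_simps)
  qed
  then have "2 * hamiltonian N V (\<lambda>i. (\<phi> i + \<psi> i) / 2)
      + (\<Sum>e\<in>bonds N. (?\<beta> (fst e) - ?\<beta> (snd e))\<^sup>2) / (2 * c) \<le> hamiltonian N V \<phi> + hamiltonian N V \<psi>"
    by (simp add: hamiltonian_bonds sum.distrib flip: sum_distrib_left sum_divide_distrib)
  with E show ?thesis by simp
qed

lemma hamiltonian_uminus: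
  assumes "interaction_potential c V"
  shows "hamiltonian N V (\<lambda>i. - \<phi> i) = hamiltonian N V \<phi>"
proof -
  have "V (- t) = V t" for t using assms by (simp add: interaction_potential_def)
  from this[of "\<phi> a - \<phi> b" for a b] show ?thesis by (simp add: hamiltonian_bonds)
qed


section \<open>The partition function with one more pinned site\<close>

lemma measurable_zero_extension_PiM [measurable]:
  assumes "\<And>i. sets (M i) = sets borel"
  shows "zero_extension S \<in> Pi\<^sub>M S M \<rightarrow>\<^sub>M Pi\<^sub>M UNIV (\<lambda>_. borel)"
proof (rule measurable_PiM_single')
  fix i
  show "(\<lambda>\<psi>. zero_extension S \<psi> i) \<in> Pi\<^sub>M S M \<rightarrow>\<^sub>M borel"
    using measurable_component_singleton[of i S M]
    by (cases "i \<in> S") (auto simp: zero_extension_def measurable_cong_sets[OF refl assms])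
qed auto

text \<open>
  Used for the symmetry of the one-site density under change of sign.
\<close>

lemma nn_integral_PiM_uminus:
  fixes F :: "('i \<Rightarrow> real) \<Rightarrow> ennreal"
  assumes "finite I" "F \<in> borel_measurable (Pi\<^sub>M UNIV (\<lambda>_. borel))"
  shows "(\<integral>\<^sup>+\<psi>. F (\<lambda>i. - zero_extension I \<psi> i) \<partial>Pi\<^sub>M I (\<lambda>_. lborel)) =
    (\<integral>\<^sup>+\<psi>. F (zero_extension I \<psi>) \<partial>Pi\<^sub>M I (\<lambda>_. lborel))"
proof -
  interpret product_sigma_finite "\<lambda>_::'i. lborel :: real measure" by standard
  show ?thesis using assms
  proof (induction I arbitrary: F rule: finite_induct)
    case empty
    then show ?case by (simp add: nn_integral_empty zero_extension_def)
  next
    case (insert j I)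
    note F = insert.prems and [measurable] = insert.prems
    have ext: "zero_extension (insert j I) (\<psi>(j := t)) = (zero_extension I \<psi>)(j := t)" for \<psi> :: "'i \<Rightarrow> real" and t
      using insert.hyps by (auto simp: zero_extension_def)
    have m1: "(\<lambda>\<psi>. F (zero_extension (insert j I) \<psi>)) \<in> borel_measurable (Pi\<^sub>M (insert j I) (\<lambda>_. lborel))"
      by measurable
    have neg: "(\<lambda>\<phi> i. - \<phi> i) \<in> Pi\<^sub>M UNIV (\<lambda>_::'i. borel::real measure) \<rightarrow>\<^sub>M Pi\<^sub>M UNIV (\<lambda>_. borel)"
      by (rule measurable_PiM_single') auto
    have m2: "(\<lambda>\<psi>. F (\<lambda>i. - zero_extension (insert j I) \<psi> i)) \<in> borel_measurable (Pi\<^sub>M (insert j I) (\<lambda>_. lborel))"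
      by (rule measurable_compose[OF _ measurable_compose[OF neg F]]) measurable
    have upd: "(\<lambda>\<phi>. F (\<phi>(j := t))) \<in> borel_measurable (Pi\<^sub>M UNIV (\<lambda>_. borel))" for t
      by (rule measurable_compose[OF _ F], rule measurable_PiM_single') auto
    have inner: "(\<integral>\<^sup>+\<psi>. F ((\<lambda>i. - zero_extension I \<psi> i)(j := t)) \<partial>Pi\<^sub>M I (\<lambda>_. lborel))
       = (\<integral>\<^sup>+\<psi>. F ((zero_extension I \<psi>)(j := t)) \<partial>Pi\<^sub>M I (\<lambda>_. lborel))" for t
      by (rule insert.IH[OF upd])
    have m3: "(\<lambda>t. \<integral>\<^sup>+\<psi>. F ((zero_extension I \<psi>)(j := t)) \<partial>Pi\<^sub>M I (\<lambda>_. lborel)) \<in> borel_measurable borel"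
    proof -
      interpret finite_product_sigma_finite "\<lambda>_::'i. lborel :: real measure" I
        by standard (rule insert.hyps)
      have "(\<lambda>t. \<integral>\<^sup>+\<psi>. F (zero_extension (insert j I) (\<psi>(j := t))) \<partial>Pi\<^sub>M I (\<lambda>_. lborel)) \<in> borel_measurable lborel"
        by measurable
      then show ?thesis by (simp add: ext)
    qed
    have "(\<lambda>i. - zero_extension (insert j I) (\<psi>(j := t)) i) = (\<lambda>i. - zero_extension I \<psi> i)(j := - t)"
      for \<psi> :: "'i \<Rightarrow> real" and t
      using insert.hyps by (auto simp: zero_extension_def)
    then have "(\<integral>\<^sup>+\<psi>. F (\<lambda>i. - zero_extension (insert j I) \<psi> i) \<partial>Pi\<^sub>M (insert j I) (\<lambda>_. lborel))
      = (\<integral>\<^sup>+t. \<integral>\<^sup>+\<psi>. F ((zero_extension I \<psi>)(j := - t)) \<partial>Pi\<^sub>M I (\<lambda>_. lborel) \<partial>lborel)"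
      using insert.hyps m2 by (simp add: product_nn_integral_insert_rev inner)
    also have "\<dots> = (\<integral>\<^sup>+t. \<integral>\<^sup>+\<psi>. F ((zero_extension I \<psi>)(j := t)) \<partial>Pi\<^sub>M I (\<lambda>_. lborel) \<partial>lborel)"
      using nn_integral_real_affine[OF m3, of "-1" 0] by simp
    also have "\<dots> = (\<integral>\<^sup>+\<psi>. F (zero_extension (insert j I) \<psi>) \<partial>Pi\<^sub>M (insert j I) (\<lambda>_. lborel))"
      using insert.hyps m1 by (simp add: product_nn_integral_insert_rev ext)
    finally show ?case .
  qed
qed

lemma nn_integral_gaussian:
  assumes "0 < a"
  shows "(\<integral>\<^sup>+s. ennreal (exp (- s\<^sup>2 / a)) \<partial>lborel) = ennreal (sqrt (pi * a))"
proof -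
  define \<sigma> where "\<sigma> = sqrt (a / 2)"
  have \<sigma>: "0 < \<sigma>" "2 * \<sigma>\<^sup>2 = a" using assms by (auto simp: \<sigma>_def)
  have "exp (- s\<^sup>2 / a) = sqrt (pi * a) * normal_density 0 \<sigma> s" for s
  proof -
    have "2 * pi * \<sigma>\<^sup>2 = pi * a" using \<sigma>(2) by simp
    then have "normal_density 0 \<sigma> s = exp (- s\<^sup>2 / a) / sqrt (pi * a)"
      unfolding normal_density_def \<sigma>(2) by simp
    then show ?thesis using assms by simp
  qed
  then have "(\<integral>\<^sup>+s. ennreal (exp (- s\<^sup>2 / a)) \<partial>lborel)
      = (\<integral>\<^sup>+s. ennreal (sqrt (pi * a)) * ennreal (normal_density 0 \<sigma> s) \<partial>lborel)"
    using assms by (simp add: ennreal_mult)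
  also have "\<dots> = ennreal (sqrt (pi * a)) * (\<integral>\<^sup>+s. ennreal (normal_density 0 \<sigma> s) \<partial>lborel)"
    by (rule nn_integral_cmult) measurable
  also have "(\<integral>\<^sup>+s. ennreal (normal_density 0 \<sigma> s) \<partial>lborel) = 1"
    using \<sigma> by (subst nn_integral_eq_integral) (auto simp: integral_normal_density)
  finally show ?thesis by simp
qed

lemma ennreal_power2_le_imp_le: "a \<le> b" if "a\<^sup>2 \<le> b\<^sup>2" for a b :: ennreal
proof (cases b)
  case (real r)
  then have "a \<noteq> \<top>" using that by (auto simp: power2_eq_square ennreal_mult_eq_top_iff top_unique)
  then obtain a' where a': "a = ennreal a'" "0 \<le> a'" by (metis ennreal_cases)
  then have "a'\<^sup>2 \<le> r\<^sup>2" using that real by (simp add: ennreal_power)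
  then show ?thesis using a' real by (auto intro: ennreal_leI power2_le_imp_le)
qed simp

text \<open>
  The one-site density \<open>g\<close> at \<open>x\<close> satisfies \<open>g s \<le> exp (- s\<^sup>2 / (4 * c * L)) * g 0\<close>, and its integral is the
  partition function in which \<open>x\<close> is free, while \<open>g 0\<close> is the one in which \<open>x\<close> is pinned.
\<close>

lemma dry_partition_insert:
  assumes V: "interaction_potential c V" and D: "- lattice_box N \<subseteq> D" and x: "x \<notin> D"
    and d: "d \<in> D" "ldist x d \<le> L" "0 < L"
  shows "dry_partition N V D \<le> ennreal (sqrt (4 * pi * c * real L)) * dry_partition N V (insert x D)"
proof -
  have c: "c \<ge> 1" using V by (simp add: interaction_potential_def)
  interpret product_sigma_finite "\<lambda>_::site. lborel :: real measure" by standard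
  define S where "S = lattice_box N - insert x D"
  have S: "finite S" "x \<notin> S" "lattice_box N - D = insert x S" "lattice_box N - insert x D = S"
    using D x by (auto simp: S_def)
  note [measurable] = measurable_hamiltonian[OF V]
  define W where "W \<phi> = ennreal (exp (- hamiltonian N V \<phi>))" for \<phi>
  have [measurable]: "W \<in> borel_measurable (Pi\<^sub>M UNIV (\<lambda>_. borel))"
    unfolding W_def by measurable
  define g where "g s = (\<integral>\<^sup>+\<psi>. W ((zero_extension S \<psi>)(x := s)) \<partial>Pi\<^sub>M S (\<lambda>_. lborel))" for s
  have upd: "(\<lambda>\<phi>. W (\<phi>(x := t))) \<in> borel_measurable (Pi\<^sub>M UNIV (\<lambda>_. borel))" for t
    by (rule measurable_compose[where g = W and N = "Pi\<^sub>M UNIV (\<lambda>_. borel)"],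
        rule measurable_PiM_single') auto
  have ext: "zero_extension (insert x S) (\<psi>(x := t)) = (zero_extension S \<psi>)(x := t)" for \<psi> :: "site \<Rightarrow> real" and t
    using S(2) by (auto simp: zero_extension_def)
  have g0: "g 0 = dry_partition N V (insert x D)"
  proof -
    have "(zero_extension S \<psi>)(x := 0) = zero_extension S \<psi>" for \<psi>
      using S(2) by (auto simp: zero_extension_def)
    then show ?thesis by (simp add: g_def dry_partition_def S W_def)
  qed
  have "(\<lambda>\<psi>. W (zero_extension (insert x S) \<psi>)) \<in> borel_measurable (Pi\<^sub>M (insert x S) (\<lambda>_. lborel))"
    by measurable
  then have gint: "dry_partition N V D = (\<integral>\<^sup>+s. g s \<partial>lborel)"
    unfolding dry_partition_def S(3) W_def[symmetric] g_def ext[symmetric]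
    by (rule product_nn_integral_insert_rev[OF S(1,2)])
  have sym: "g (- s) = g s" for s
  proof -
    have "g s = (\<integral>\<^sup>+\<psi>. W ((\<lambda>i. - zero_extension S \<psi> i)(x := s)) \<partial>Pi\<^sub>M S (\<lambda>_. lborel))"
      unfolding g_def by (rule nn_integral_PiM_uminus[OF S(1) upd, symmetric])
    also have "\<dots> = g (- s)"
      unfolding g_def
    proof (rule nn_integral_cong)
      fix \<psi> :: "site \<Rightarrow> real"
      have "(\<lambda>i. - zero_extension S \<psi> i)(x := s) = (\<lambda>i. - ((zero_extension S \<psi>)(x := - s)) i)"
        by auto
      then show "W ((\<lambda>i. - zero_extension S \<psi> i)(x := s)) = W ((zero_extension S \<psi>)(x := - s))"
        by (simp only: W_def hamiltonian_uminus[OF V])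
    qed
    finally show ?thesis by simp
  qed
  let ?a = "4 * c * real L"
  have gs: "g s \<le> ennreal (exp (- s\<^sup>2 / ?a)) * g 0" for s
  proof -
    let ?e = "ennreal (exp (- s\<^sup>2 / ?a))"
    have m: "(\<lambda>\<psi>. W ((zero_extension S \<psi>)(x := t))) \<in> borel_measurable (Pi\<^sub>M S (\<lambda>_. lborel))" for t
      by (rule measurable_compose[OF _ upd]) measurable
    have int0: "(\<integral>\<^sup>+\<psi>. ?e * W ((zero_extension S \<psi>)(x := 0)) \<partial>Pi\<^sub>M S (\<lambda>_. lborel)) = ?e * g 0"
      unfolding g_def by (rule nn_integral_cmult[OF m])
    have "g s * g (- s) \<le> (\<integral>\<^sup>+\<psi>. ?e * W ((zero_extension S \<psi>)(x := 0)) \<partial>Pi\<^sub>M S (\<lambda>_. lborel))\<^sup>2"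
      unfolding g_def[of s] g_def[of "- s"]
    proof (rule prekopa_leindler_PiM[OF S(1)])
      fix \<phi> \<psi> :: "site \<Rightarrow> real"
      let ?f = "(zero_extension S \<phi>)(x := s)" and ?g = "(zero_extension S \<psi>)(x := - s)"
      let ?m = "(zero_extension S (\<lambda>i. (\<phi> i + \<psi> i) / 2))(x := 0)"
      have m: "(\<lambda>i. (?f i + ?g i) / 2) = ?m"
        by (auto simp: zero_extension_def)
      have "d \<notin> S" "d \<noteq> x" using d x by (auto simp: S_def)
      then have "2 * hamiltonian N V (\<lambda>i. (?f i + ?g i) / 2) + s\<^sup>2 / (2 * c * real L)
          \<le> hamiltonian N V ?f + hamiltonian N V ?g"
        using D x by (intro hamiltonian_midpoint[OF V, where d = d and x = x] d)
          (auto simp: zero_extension_def S_def)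
      then have "- hamiltonian N V ?f + - hamiltonian N V ?g
          \<le> 2 * (- s\<^sup>2 / ?a + - hamiltonian N V ?m)"
        unfolding m using c d by (simp add: field_simps)
      then have "exp (- hamiltonian N V ?f) * exp (- hamiltonian N V ?g)
          \<le> (exp (- s\<^sup>2 / ?a) * exp (- hamiltonian N V ?m))\<^sup>2"
        by (simp only: exp_add[symmetric] exp_double[symmetric] exp_le_cancel_iff)
      then show "W ?f * W ?g \<le> (?e * W ?m)\<^sup>2"
        by (simp add: W_def ennreal_power ennreal_leI flip: ennreal_mult)
    qed (use m in auto)
    then have "(g s)\<^sup>2 \<le> (?e * g 0)\<^sup>2"
      by (simp only: int0 sym power2_eq_square[of "g s"])
    then show ?thesis
      by (rule ennreal_power2_le_imp_le)
  qed
  have "dry_partition N V D \<le> (\<integral>\<^sup>+s. ennreal (exp (- s\<^sup>2 / ?a)) * g 0 \<partial>lborel)"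
    unfolding gint by (intro nn_integral_mono gs)
  also have "\<dots> = ennreal (sqrt (pi * ?a)) * g 0"
    using nn_integral_gaussian[of ?a] c d by (subst nn_integral_multc) auto
  finally show ?thesis by (simp add: g0 ac_simps)
qed

section \<open>The law of the dry set\<close>

lemma sigma_finite_site_measure: "sigma_finite_measure (site_measure J)"
proof
  let ?A = "range (\<lambda>n::nat. {- real n..real n})"
  have "\<exists>n::nat. \<bar>x\<bar> \<le> real n" for x :: real by (rule real_arch_simple)
  then have "\<exists>n::nat. - real n \<le> x \<and> x \<le> real n" for x :: real
    by (metis abs_le_iff minus_le_iff)
  then have "\<Union>?A = UNIV" by auto
  then show "\<exists>A. countable A \<and> A \<subseteq> sets (site_measure J) \<and> \<Union>A = space (site_measure J) \<and>
      (\<forall>a\<in>A. emeasure (site_measure J) a \<noteq> \<infinity>)"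
    by (intro exI[of _ ?A]) (auto simp: emeasure_site_measure ennreal_mult_eq_top_iff)
qed

lemma nn_integral_site_measure:
  assumes "G \<in> borel_measurable borel"
  shows "(\<integral>\<^sup>+y. G y \<partial>site_measure J) = (\<integral>\<^sup>+y. G y \<partial>lborel) + ennreal (exp J) * G 0"
  using assms
proof (induction rule: borel_measurable_induct)
  case (cong f g)
  then show ?case by (metis ext UNIV_I space_borel)
next
  case (set A)
  then show ?case by (simp add: emeasure_site_measure)
next
  case (mult u c)
  then show ?case
    by (simp add: nn_integral_cmult distrib_left ac_simps measurable_cong_sets[OF sets_site_measure refl])
next
  case (add u v)
  then show ?case
    by (simp add: nn_integral_add distrib_left ac_simps measurable_cong_sets[OF sets_site_measure refl])
next
  case (seq U)
  have U: "U i \<in> borel_measurable (site_measure J)" "U i \<in> borel_measurable lborel" for i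
    using seq by (auto simp: measurable_cong_sets[OF sets_site_measure refl])
  have inc: "incseq (\<lambda>i. ennreal (exp J) * U i 0)" "incseq (\<lambda>i. \<integral>\<^sup>+y. U i y \<partial>lborel)"
    using seq by (auto simp: incseq_def le_fun_def intro!: mult_left_mono nn_integral_mono)
  have "(\<integral>\<^sup>+y. (SUP i. U i) y \<partial>site_measure J) = (SUP i. \<integral>\<^sup>+y. U i y \<partial>site_measure J)"
    unfolding SUP_apply by (rule nn_integral_monotone_convergence_SUP) (use seq U in auto)
  also have "\<dots> = (SUP i. (\<integral>\<^sup>+y. U i y \<partial>lborel) + ennreal (exp J) * U i 0)"
    using seq by simp
  also have "\<dots> = (SUP i. \<integral>\<^sup>+y. U i y \<partial>lborel) + (SUP i. ennreal (exp J) * U i 0)"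
    by (rule ennreal_SUP_add[OF inc(2,1)])
  also have "(SUP i. \<integral>\<^sup>+y. U i y \<partial>lborel) = (\<integral>\<^sup>+y. (SUP i. U i) y \<partial>lborel)"
    unfolding SUP_apply by (rule nn_integral_monotone_convergence_SUP[symmetric]) (use seq U in auto)
  also have "(SUP i. ennreal (exp J) * U i 0) = ennreal (exp J) * (SUP i. U i) 0"
    by (simp add: SUP_mult_left_ennreal image_comp)
  finally show ?case .
qed

text \<open>
  Expanding the product of the measures \<open>dt + exp J * \<delta>\<close> over the sites: a prescribed zero pattern
  selects the atom at each site of \<open>A\<close>, and the Lebesgue part, for which \<open>0\<close> is a null set, elsewhere.
\<close>

lemma nn_integral_dry_pattern:
  fixes F :: "(site \<Rightarrow> real) \<Rightarrow> ennreal"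
  assumes "finite I" "A \<subseteq> I" "F \<in> borel_measurable (Pi\<^sub>M UNIV (\<lambda>_. borel))"
  shows "(\<integral>\<^sup>+\<phi>. F (zero_extension I \<phi>) * indicator {\<phi>. \<forall>i\<in>I. \<phi> i = 0 \<longleftrightarrow> i \<in> A} \<phi>
      \<partial>Pi\<^sub>M I (\<lambda>_. site_measure J)) =
    ennreal (exp J) ^ card A *
      (\<integral>\<^sup>+\<psi>. F (zero_extension (I - A) \<psi>) \<partial>Pi\<^sub>M (I - A) (\<lambda>_. lborel))"
proof -
  interpret site: product_sigma_finite "\<lambda>_::site. site_measure J"
    by (simp add: product_sigma_finite_def sigma_finite_site_measure)
  interpret leb: product_sigma_finite "\<lambda>_::site. lborel :: real measure" by standard
  show ?thesis using assms
  proof (induction I arbitrary: A F rule: finite_induct)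
    case empty
    then show ?case by (simp add: PiM_empty zero_extension_def)
  next
    case (insert j I)
    note F = insert.prems(2) and [measurable] = insert.prems(2)
    have A: "finite A" using insert finite_subset by blast
    let ?B = "\<lambda>I A. {\<phi>::site \<Rightarrow> real. \<forall>i\<in>I. \<phi> i = 0 \<longleftrightarrow> i \<in> A}"
    have ext: "zero_extension (insert j I') (\<psi>(j := t)) = (zero_extension I' \<psi>)(j := t)"
      if "j \<notin> I'" for \<psi> :: "site \<Rightarrow> real" and t I'
      using that by (auto simp: zero_extension_def)
    have upd: "(\<lambda>\<phi>. F (\<phi>(j := t))) \<in> borel_measurable (Pi\<^sub>M UNIV (\<lambda>_. borel))" for t
      by (rule measurable_compose[OF _ F], rule measurable_PiM_single') auto
    have ind: "indicator (?B (insert j I) A) (\<phi>(j := t)) =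
        (indicator (?B I (A - {j})) \<phi> * of_bool (t = 0 \<longleftrightarrow> j \<in> A) :: ennreal)" for \<phi> t
      using insert.hyps by (auto simp: indicator_def)
    let ?K = "\<lambda>t. \<integral>\<^sup>+\<psi>. F ((zero_extension (I - A) \<psi>)(j := t)) \<partial>Pi\<^sub>M (I - A) (\<lambda>_. lborel)"
    let ?E = "ennreal (exp J)"
    have K: "?K \<in> borel_measurable borel"
    proof -
      interpret finite_product_sigma_finite "\<lambda>_::site. lborel :: real measure" "I - A"
        by standard (use insert.hyps in auto)
      have "(\<lambda>t. \<integral>\<^sup>+\<psi>. F (zero_extension (insert j (I - A)) (\<psi>(j := t))) \<partial>Pi\<^sub>M (I - A) (\<lambda>_. lborel))
          \<in> borel_measurable lborel"
        by measurable
      then show ?thesis using insert.hyps by (simp add: ext)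
    qed
    have IA: "I - (A - {j}) = I - A" using insert.hyps by auto
    have inner: "(\<integral>\<^sup>+\<phi>. F ((zero_extension I \<phi>)(j := t)) * indicator (?B I (A - {j})) \<phi>
        \<partial>Pi\<^sub>M I (\<lambda>_. site_measure J)) = ?E ^ card (A - {j}) * ?K t" for t
    proof -
      have "A - {j} \<subseteq> I" using insert.prems(1) by auto
      from insert.IH[OF this upd, of t] show ?thesis unfolding IA .
    qed
    have mB: "?B (insert j I) A \<inter> space (Pi\<^sub>M (insert j I) (\<lambda>_. site_measure J))
        \<in> sets (Pi\<^sub>M (insert j I) (\<lambda>_. site_measure J))"
    proof -
      have "{\<phi> \<in> space (Pi\<^sub>M (insert j I) (\<lambda>_. site_measure J)). \<forall>i\<in>insert j I. (\<phi> i = 0) = (i \<in> A)}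
          \<in> sets (Pi\<^sub>M (insert j I) (\<lambda>_. site_measure J))"
        using insert.hyps by measurable
      then show ?thesis by (simp add: Int_def conj_commute)
    qed
    have m: "(\<lambda>\<phi>. F (zero_extension (insert j I) \<phi>) * indicator (?B (insert j I) A) \<phi>)
        \<in> borel_measurable (Pi\<^sub>M (insert j I) (\<lambda>_. site_measure J))"
      using mB by measurable
    have "(\<integral>\<^sup>+\<phi>. F (zero_extension (insert j I) \<phi>) * indicator (?B (insert j I) A) \<phi>
          \<partial>Pi\<^sub>M (insert j I) (\<lambda>_. site_measure J))
        = (\<integral>\<^sup>+t. \<integral>\<^sup>+\<phi>. F ((zero_extension I \<phi>)(j := t)) * indicator (?B I (A - {j})) \<phi> * of_bool (t = 0 \<longleftrightarrow> j \<in> A)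
          \<partial>Pi\<^sub>M I (\<lambda>_. site_measure J) \<partial>site_measure J)"
      unfolding site.product_nn_integral_insert_rev[OF insert.hyps m] ind ext[OF insert.hyps(2)] by (simp add: mult.assoc)
    also have "\<dots> = (\<integral>\<^sup>+t. ?E ^ card (A - {j}) * (?K t * of_bool (t = 0 \<longleftrightarrow> j \<in> A)) \<partial>site_measure J)"
      by (rule nn_integral_cong) (use inner in \<open>auto simp: mult.assoc\<close>)
    also have "\<dots> = ?E ^ card (A - {j}) * (\<integral>\<^sup>+t. ?K t * of_bool (t = 0 \<longleftrightarrow> j \<in> A) \<partial>site_measure J)"
      by (rule nn_integral_cmult) (use K in \<open>simp add: measurable_cong_sets[OF sets_site_measure refl]\<close>)
    also have "(\<integral>\<^sup>+t. ?K t * of_bool (t = 0 \<longleftrightarrow> j \<in> A) \<partial>site_measure J)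
        = (\<integral>\<^sup>+t. ?K t * of_bool (t = 0 \<longleftrightarrow> j \<in> A) \<partial>lborel) + ?E * (?K 0 * of_bool (j \<in> A))"
      by (subst nn_integral_site_measure) (use K in auto)
    also have "?E ^ card (A - {j}) * \<dots> = ?E ^ card A *
      (\<integral>\<^sup>+\<psi>. F (zero_extension (insert j I - A) \<psi>) \<partial>Pi\<^sub>M (insert j I - A) (\<lambda>_. lborel))"
    proof (cases "j \<in> A")
      case True
      have "(\<integral>\<^sup>+t. ?K t * of_bool (t = 0 \<longleftrightarrow> j \<in> A) \<partial>lborel) = (\<integral>\<^sup>+t. 0 \<partial>(lborel :: real measure))"
        by (rule nn_integral_cong_AE, rule AE_mp[OF AE_lborel_singleton[of 0]]) (use True in auto)
      moreover have "(zero_extension (I - A) \<psi>)(j := 0) = zero_extension (I - A) \<psi>" for \<psi>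
        using True by (auto simp: zero_extension_def)
      moreover have "?E ^ card A = ?E * ?E ^ card (A - {j})"
        by (metis card_Suc_Diff1[OF A True] power_Suc)
      moreover have "insert j I - A = I - A"
        using True by auto
      ultimately show ?thesis
        using True by (simp add: ac_simps del: card_Diff_singleton card_Diff_insert)
    next
      case False
      have "(\<integral>\<^sup>+t. ?K t * of_bool (t = 0 \<longleftrightarrow> j \<in> A) \<partial>lborel) = (\<integral>\<^sup>+t. ?K t \<partial>lborel)"
        by (rule nn_integral_cong_AE, rule AE_mp[OF AE_lborel_singleton[of 0]]) (use False in auto)
      also have "\<dots> = (\<integral>\<^sup>+\<psi>. F (zero_extension (insert j (I - A)) \<psi>) \<partial>Pi\<^sub>M (insert j (I - A)) (\<lambda>_. lborel))"
        using insert.hyps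
        by (subst leb.product_nn_integral_insert_rev) (auto simp: ext)
      also have "insert j (I - A) = insert j I - A" using False by auto
      finally show ?thesis
        by (simp only: False of_bool_eq mult_zero_right add_0_right Diff_insert0 Diff_empty not_False_eq_True)
    qed
    finally show ?case .
  qed
qed

lemma emeasure_pinned_measure_dry_set:
  assumes V: "interaction_potential c V" and A: "- lattice_box N \<subseteq> A"
  shows "emeasure (pinned_measure N V J) {\<phi>. dry_set \<phi> = A} =
    ennreal (exp J) ^ card (A \<inter> lattice_box N) * (dry_partition N V A / partition_function N V J)"
proof -
  note [measurable] = measurable_hamiltonian[OF V]
  let ?I = "lattice_box N" and ?Z = "partition_function N V J"
  define F where "F \<phi> = ennreal (exp (- hamiltonian N V \<phi>)) / ?Z" for \<phi>
  have F [measurable]: "F \<in> borel_measurable (Pi\<^sub>M UNIV (\<lambda>_. borel))"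
    unfolding F_def by measurable
  have sets [measurable]: "{\<phi>. dry_set \<phi> = A} \<in> sets (Pi\<^sub>M UNIV (\<lambda>_. borel))"
    using sets_dry_set_eq[of A N V J] by (simp add: pinned_measure_def reference_measure_def)
  have zext: "(\<lambda>\<phi> i. if i \<in> ?I then \<phi> i else 0) = zero_extension ?I"
    by (auto simp: zero_extension_def fun_eq_iff)
  have zm: "zero_extension ?I \<in> Pi\<^sub>M ?I (\<lambda>_. site_measure J) \<rightarrow>\<^sub>M Pi\<^sub>M UNIV (\<lambda>_. borel)"
    by (rule measurable_zero_extension_PiM) simp
  have dry: "dry_set (zero_extension ?I \<phi>) = A \<longleftrightarrow> (\<forall>i\<in>?I. \<phi> i = 0 \<longleftrightarrow> i \<in> A \<inter> ?I)" for \<phi>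
    using A by (auto simp: dry_set_def zero_extension_def split: if_splits)
  have "emeasure (pinned_measure N V J) {\<phi>. dry_set \<phi> = A}
      = (\<integral>\<^sup>+\<phi>. F \<phi> * indicator {\<phi>. dry_set \<phi> = A} \<phi> \<partial>reference_measure N J)"
    unfolding pinned_measure_def F_def[symmetric]
    by (rule emeasure_density) (use F sets in \<open>auto simp: reference_measure_def\<close>)
  also have "\<dots> = (\<integral>\<^sup>+\<phi>. F (zero_extension ?I \<phi>) * indicator {\<phi>. dry_set \<phi> = A} (zero_extension ?I \<phi>)
      \<partial>Pi\<^sub>M ?I (\<lambda>_. site_measure J))"
    unfolding reference_measure_def zext by (rule nn_integral_distr[OF zm]) measurable
  also have "\<dots> = (\<integral>\<^sup>+\<phi>. F (zero_extension ?I \<phi>) *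
      indicator {\<phi>. \<forall>i\<in>?I. \<phi> i = 0 \<longleftrightarrow> i \<in> A \<inter> ?I} \<phi> \<partial>Pi\<^sub>M ?I (\<lambda>_. site_measure J))"
    by (rule nn_integral_cong) (simp only: indicator_def mem_Collect_eq dry)
  also have "\<dots> = ennreal (exp J) ^ card (A \<inter> ?I) *
      (\<integral>\<^sup>+\<psi>. F (zero_extension (?I - A \<inter> ?I) \<psi>) \<partial>Pi\<^sub>M (?I - A \<inter> ?I) (\<lambda>_. lborel))"
    by (rule nn_integral_dry_pattern) auto
  also have "?I - A \<inter> ?I = ?I - A" by auto
  also have "(\<integral>\<^sup>+\<psi>. F (zero_extension (?I - A) \<psi>) \<partial>Pi\<^sub>M (?I - A) (\<lambda>_. lborel)) = dry_partition N V A / ?Z"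
    unfolding F_def dry_partition_def by (rule nn_integral_divide) measurable
  finally show ?thesis .
qed

text \<open>
  The bound holds whatever the value of the partition function. If it is \<open>0\<close>, the
  reference measure is null because the weight is strictly positive; if it is \<open>\<infinity>\<close>, the density is \<open>0\<close>.
\<close>

lemma emeasure_pinned_measure_le_1:
  assumes V: "interaction_potential c V"
  shows "emeasure (pinned_measure N V J) S \<le> 1"
proof -
  note [measurable] = measurable_hamiltonian[OF V]
  let ?M = "reference_measure N J" and ?Z = "partition_function N V J"
  have sets: "sets ?M = sets (Pi\<^sub>M UNIV (\<lambda>_. borel))" by (simp add: reference_measure_def)
  have H [measurable]: "hamiltonian N V \<in> borel_measurable ?M"
    using measurable_hamiltonian[OF V] measurable_cong_sets[OF sets refl] by blast
  have "emeasure (pinned_measure N V J) S \<le> emeasure (pinned_measure N V J) (space (pinned_measure N V J))"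
    by (rule emeasure_space)
  also have "\<dots> = (\<integral>\<^sup>+\<phi>. ennreal (exp (- hamiltonian N V \<phi>)) / ?Z * indicator (space ?M) \<phi> \<partial>?M)"
    unfolding pinned_measure_def by (subst emeasure_density) auto
  also have "\<dots> = (\<integral>\<^sup>+\<phi>. ennreal (exp (- hamiltonian N V \<phi>)) / ?Z \<partial>?M)"
    by (rule nn_integral_cong) simp
  also have "\<dots> \<le> 1"
  proof (cases "?Z = 0")
    case True
    then have "AE \<phi> in ?M. ennreal (exp (- hamiltonian N V \<phi>)) = 0"
      unfolding partition_function_def by (subst (asm) nn_integral_0_iff_AE) auto
    then have "AE \<phi> in ?M. ennreal (exp (- hamiltonian N V \<phi>)) / ?Z = 0"
      by eventually_elim (metis exp_gt_zero ennreal_eq_0_iff not_le)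
    then have "(\<integral>\<^sup>+\<phi>. ennreal (exp (- hamiltonian N V \<phi>)) / ?Z \<partial>?M) = (\<integral>\<^sup>+\<phi>. 0 \<partial>?M)"
      by (rule nn_integral_cong_AE)
    then show ?thesis by simp
  next
    case False
    have "(\<integral>\<^sup>+\<phi>. ennreal (exp (- hamiltonian N V \<phi>)) / ?Z \<partial>?M) = ?Z / ?Z"
      unfolding partition_function_def by (rule nn_integral_divide) measurable
    also have "\<dots> \<le> 1"
      using False by (cases "?Z = \<top>") (auto simp: ennreal_divide_self less_top)
    finally show ?thesis .
  qed
  finally show ?thesis .
qed

lemma emeasure_pinned_measure_finite:
  assumes V: "interaction_potential c V"
  shows "emeasure (pinned_measure N V J) S \<noteq> \<infinity>"
  using emeasure_pinned_measure_le_1[OF V, of N J S] by (auto simp: top_unique)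

lemma sum_dry_law_le_1:
  assumes V: "interaction_potential c V" and "finite \<A>"
  shows "(\<Sum>A\<in>\<A>. dry_law N V J A) \<le> 1"
proof -
  let ?P = "pinned_measure N V J" and ?S = "\<lambda>A. {\<phi>. dry_set \<phi> = A}"
  have "(\<Sum>A\<in>\<A>. dry_law N V J A) = measure ?P (\<Union>A\<in>\<A>. ?S A)"
    unfolding dry_law_def
    by (rule measure_finite_Union[symmetric])
       (use assms sets_dry_set_eq emeasure_pinned_measure_finite[OF V] in \<open>auto simp: disjoint_family_on_def\<close>)
  also have "\<dots> \<le> 1"
    using emeasure_pinned_measure_le_1[OF V] by (simp add: measure_def enn2real_leI)
  finally show ?thesis .
qed

text \<open>
  The cost of pinning one more site, in the only form in which the interaction enters the
  combinatorial argument.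
\<close>

lemma dry_law_insert:
  assumes V: "interaction_potential c V" and D: "- lattice_box N \<subseteq> D" and x: "x \<notin> D"
    and d: "d \<in> D" "ldist x d \<le> L" "0 < L"
  shows "exp J / sqrt (4 * pi * c * real L) * dry_law N V J D \<le> dry_law N V J (insert x D)"
proof -
  have c: "c \<ge> 1" using V by (simp add: interaction_potential_def)
  let ?P = "\<lambda>A. emeasure (pinned_measure N V J) {\<phi>. dry_set \<phi> = A}"
  let ?Z = "partition_function N V J" and ?s = "sqrt (4 * pi * c * real L)"
  have s: "0 < ?s" using c d by simp
  have real: "?P A = ennreal (dry_law N V J A)" for A
    using emeasure_pinned_measure_finite[OF V, of N J] by (simp add: dry_law_def emeasure_eq_ennreal_measure)
  have "insert x D \<inter> lattice_box N = insert x (D \<inter> lattice_box N)" using D x by auto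
  then have card: "card (insert x D \<inter> lattice_box N) = Suc (card (D \<inter> lattice_box N))"
    using x by simp
  have "- lattice_box N \<subseteq> insert x D" using D by auto
  note P = emeasure_pinned_measure_dry_set[OF V D, of J] emeasure_pinned_measure_dry_set[OF V this, of J]
  have "ennreal (exp J) * ?P D \<le>
      ennreal (exp J) * (ennreal (exp J) ^ card (D \<inter> lattice_box N) *
        (ennreal ?s * dry_partition N V (insert x D) / ?Z))"
    unfolding P by (intro mult_left_mono divide_right_mono_ennreal dry_partition_insert[OF V D x d]) auto
  also have "\<dots> = ennreal ?s * ?P (insert x D)"
    unfolding P card by (simp add: ennreal_times_divide ac_simps)
  finally have "exp J * dry_law N V J D \<le> ?s * dry_law N V J (insert x D)"
    unfolding real using s by (simp add: dry_law_def flip: ennreal_mult)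
  then show ?thesis
    using s by (simp add: field_simps)
qed

section \<open>Pinning a set that is attached to the dry set\<close>

lemma ldist_commute: "ldist i j = ldist j i"
  by (simp add: ldist_def abs_minus_commute)

lemma ldist_triangle: "ldist i k \<le> ldist i j + ldist j k"
  unfolding ldist_def by linarith

lemma ldist_self [simp]: "ldist i i = 0"
  by (simp add: ldist_def)

lemma ldist_ball_subset:
  "{y. ldist x y \<le> r} \<subseteq> {fst x - int r..fst x + int r} \<times> {snd x - int r..snd x + int r}"
  by (auto simp: ldist_def)

lemma card_ldist_ball: "card {y. ldist x y \<le> r} \<le> (2 * r + 1)\<^sup>2"
proof -
  have "card {y. ldist x y \<le> r}
      \<le> card ({fst x - int r..fst x + int r} \<times> {snd x - int r..snd x + int r})"
    by (intro card_mono ldist_ball_subset) auto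
  also have "\<dots> = (2 * r + 1)\<^sup>2"
    by (simp add: card_cartesian_product power2_eq_square nat_add_distrib nat_mult_distrib)
  finally show ?thesis .
qed

lemma finite_ldist_ball: "finite {y. ldist x y \<le> r}"
  by (rule finite_subset[OF ldist_ball_subset]) simp

definition bonds_in :: "site set \<Rightarrow> (site \<times> site) set" where
  "bonds_in T = {(x, y). x \<in> T \<and> y \<in> T \<and> nbr x y}"

text \<open>
  For \<open>T\<close> disjoint from \<open>D\<close> this says that a path inside \<open>T\<close> joins every site of \<open>T\<close> to a neighbour of
  \<open>D\<close>. Phrasing it as the absence of isolated parts supplies the bond at which the next block is found.
\<close>

definition attached :: "site set \<Rightarrow> site set \<Rightarrow> bool" where
  "attached D T \<longleftrightarrow> (\<forall>G. G \<subseteq> T \<and> G \<noteq> {} \<longrightarrow> (\<exists>y\<in>G. \<exists>y'\<in>D \<union> (T - G). nbr y y'))"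

text \<open>

\<close>

definition transversals :: "(site \<Rightarrow> site set) \<Rightarrow> site set \<Rightarrow> site set set" where
  "transversals S Y = {C. C \<subseteq> (\<Union>y\<in>Y. S y) \<and> (\<forall>y\<in>Y. C \<inter> S y \<noteq> {})}"

lemma exists_maximal_separated:
  assumes "finite T"
  shows "\<exists>X\<subseteq>T. (\<forall>x\<in>X. \<forall>y\<in>X. x \<noteq> y \<longrightarrow> r < ldist x y) \<and> (\<forall>y\<in>T. \<exists>x\<in>X. ldist x y \<le> r)"
  using assms
proof (induction T rule: finite_induct)
  case (insert t T)
  then obtain X where X: "X \<subseteq> T" "\<forall>x\<in>X. \<forall>y\<in>X. x \<noteq> y \<longrightarrow> r < ldist x y"
      "\<forall>y\<in>T. \<exists>x\<in>X. ldist x y \<le> r"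
    by blast
  show ?case
  proof (cases "\<exists>x\<in>X. ldist x t \<le> r")
    case True
    then show ?thesis using X by (intro exI[of _ X]) auto
  next
    case False
    then show ?thesis
      using X by (intro exI[of _ "insert t X"]) (auto simp: ldist_commute[of t] not_le)
  qed
qed simp

text \<open>
  Along a nearest-neighbour path the distance from \<open>t\<close> changes by at most one per step, so every
  intermediate value is attained.
\<close>

lemma connected_local_size:
  assumes T: "finite T" and tu: "(t, u) \<in> (bonds_in T)\<^sup>*" "t \<in> T" and far: "K \<le> ldist t u"
  shows "K \<le> card {y \<in> T. ldist t y \<le> K}"
proof -
  have "\<forall>k\<le>ldist t u. \<exists>y\<in>T. ldist t y = k"
    using tu(1)
  proof (induction rule: rtrancl_induct)
    case base
    then show ?case using tu(2) by (intro allI impI bexI[of _ t]) auto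
  next
    case (step y z)
    have "ldist t z \<le> ldist t y + 1" "z \<in> T"
      using step.hyps(2) ldist_triangle[of t z y] by (auto simp: bonds_in_def nbr_ldist)
    then show ?case
      using step.IH by (metis Suc_eq_plus1 le_SucE le_antisym le_trans not_less_eq_eq)
  qed
  note levels = this
  have "{1..K} \<subseteq> ldist t ` {y \<in> T. ldist t y \<le> K}"
  proof
    fix k assume "k \<in> {1..K}"
    moreover from this have "k \<le> ldist t u" using far by auto
    then obtain y where "y \<in> T" "ldist t y = k" using levels by blast
    ultimately show "k \<in> ldist t ` {y \<in> T. ldist t y \<le> K}" by auto
  qed
  then have "card {1..K} \<le> card (ldist t ` {y \<in> T. ldist t y \<le> K})"
    using T by (intro card_mono) auto
  also have "\<dots> \<le> card {y \<in> T. ldist t y \<le> K}"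
    using T by (intro card_image_le) auto
  finally show ?thesis by simp
qed

text \<open>
  The blocks are opened one at a time. Each new block offers at least \<open>K\<close> sites, each at relative cost
  \<open>a\<close>, and the site added last can be read off from the result because the blocks are disjoint. The
  order of the blocks is not prescribed: which block comes next may depend on those already opened.
\<close>

lemma transversal_sum_bound:
  fixes q :: "site set \<Rightarrow> real"
  assumes X: "finite X" and S: "\<And>x. x \<in> X \<Longrightarrow> finite (S x) \<and> K \<le> card (S x)"
    and disj: "\<And>x y. x \<in> X \<Longrightarrow> y \<in> X \<Longrightarrow> x \<noteq> y \<Longrightarrow> S x \<inter> S y = {}"
    and q: "\<And>A. 0 \<le> q A" and a: "0 \<le> a"
    and step: "\<And>Y. Y \<subset> X \<Longrightarrow> \<exists>x\<in>X - Y. \<forall>C\<in>transversals S Y. \<forall>z\<in>S x.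
      a * q (D \<union> C) \<le> q (insert z (D \<union> C))"
  shows "(real K * a) ^ card X * q D \<le> (\<Sum>C\<in>transversals S X. q (D \<union> C))"
proof -
  have fin: "finite (transversals S Y)" if "Y \<subseteq> X" for Y
  proof (rule finite_subset)
    show "transversals S Y \<subseteq> Pow (\<Union>y\<in>Y. S y)" by (auto simp: transversals_def)
    show "finite (Pow (\<Union>y\<in>Y. S y))"
      using that S finite_subset[OF that X] by auto
  qed
  have "\<exists>Y\<subseteq>X. card Y = m \<and> (real K * a) ^ m * q D \<le> (\<Sum>C\<in>transversals S Y. q (D \<union> C))"
    if "m \<le> card X" for m
    using that
  proof (induction m)
    case 0
    have "transversals S {} = {{}}" by (auto simp: transversals_def)
    then show ?case by (intro exI[of _ "{}"]) simp
  next
    case (Suc m)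
    then obtain Y where Y: "Y \<subseteq> X" "card Y = m"
        "(real K * a) ^ m * q D \<le> (\<Sum>C\<in>transversals S Y. q (D \<union> C))"
      by auto
    then have "Y \<subset> X" using Suc.prems by auto
    from step[OF this] obtain x where x: "x \<in> X" "x \<notin> Y"
        "\<And>C z. C \<in> transversals S Y \<Longrightarrow> z \<in> S x \<Longrightarrow> a * q (D \<union> C) \<le> q (insert z (D \<union> C))"
      by blast
    have avoid: "C \<inter> S x = {}" if "C \<in> transversals S Y" for C
    proof -
      have "S y \<inter> S x = {}" if "y \<in> Y" for y using disj[of y x] x Y that by blast
      then show ?thesis using that unfolding transversals_def by blast
    qed
    let ?f = "\<lambda>(C, z). insert z C" and ?P = "transversals S Y \<times> S x"
    have inj: "inj_on ?f ?P"
    proof (rule inj_onI, clarify)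
      fix C z C' z'
      assume *: "C \<in> transversals S Y" "z \<in> S x" "C' \<in> transversals S Y" "z' \<in> S x"
        "insert z C = insert z' C'"
      then have z: "z \<notin> C" "z' \<notin> C'" "z' \<notin> C" using avoid[of C] avoid[of C'] by auto
      then have "z = z'" using *(5) by auto
      then show "C = C' \<and> z = z'" using *(5) z by auto
    qed
    have "(real K * a) ^ Suc m * q D = real K * a * ((real K * a) ^ m * q D)" by simp
    also have "\<dots> \<le> real K * a * (\<Sum>C\<in>transversals S Y. q (D \<union> C))"
      using Y a by (intro mult_left_mono) auto
    also have "\<dots> = (\<Sum>C\<in>transversals S Y. real K * (a * q (D \<union> C)))"
      by (simp add: sum_distrib_left mult.assoc)
    also have "\<dots> \<le> (\<Sum>C\<in>transversals S Y. \<Sum>z\<in>S x. q (D \<union> insert z C))"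
    proof (rule sum_mono)
      fix C assume C: "C \<in> transversals S Y"
      have "real K * (a * q (D \<union> C)) \<le> real (card (S x)) * (a * q (D \<union> C))"
        using S[OF x(1)] a q by (intro mult_right_mono) auto
      also have "\<dots> = (\<Sum>z\<in>S x. a * q (D \<union> C))" by simp
      also have "\<dots> \<le> (\<Sum>z\<in>S x. q (D \<union> insert z C))"
        using x(3)[OF C] by (intro sum_mono) simp
      finally show "real K * (a * q (D \<union> C)) \<le> (\<Sum>z\<in>S x. q (D \<union> insert z C))" .
    qed
    also have "\<dots> = (\<Sum>p\<in>?P. q (D \<union> ?f p))"
      by (simp add: sum.cartesian_product case_prod_beta)
    also have "\<dots> = (\<Sum>C\<in>?f ` ?P. q (D \<union> C))"
      by (simp add: sum.reindex[OF inj])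
    also have "\<dots> \<le> (\<Sum>C\<in>transversals S (insert x Y). q (D \<union> C))"
    proof (rule sum_mono2)
      show "finite (transversals S (insert x Y))" using fin[of "insert x Y"] x Y by simp
      show "?f ` ?P \<subseteq> transversals S (insert x Y)"
        unfolding transversals_def by clarsimp blast
    qed (use q in simp)
    finally have "(real K * a) ^ Suc m * q D \<le> (\<Sum>C\<in>transversals S (insert x Y). q (D \<union> C))" .
    moreover have "card (insert x Y) = Suc m"
      using x Y finite_subset[OF Y(1) X] by simp
    ultimately show ?case using x Y by (intro exI[of _ "insert x Y"]) auto
  qed
  from this[OF order_refl] obtain Y where Y: "Y \<subseteq> X" "card Y = card X"
      "(real K * a) ^ card X * q D \<le> (\<Sum>C\<in>transversals S Y. q (D \<union> C))"
    by blast
  have "Y = X" using card_subset_eq[OF X Y(1,2)] .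
  then show ?thesis using Y(3) by simp
qed

text \<open>
  The blocks are the balls of radius \<open>K\<close>, within \<open>T\<close>, around a maximal \<open>2 K\<close>-separated set \<open>X\<close>. Separation
  makes them disjoint, and maximality bounds \<open>card T\<close> by a multiple of \<open>card X\<close>. As long as some
  block is not open, attachedness yields a bond from the region far from the open blocks to its
  complement, and a block near that bond lies within \<open>7 K\<close> of a pinned site.
\<close>

lemma attached_pinning_gain:
  fixes q :: "site set \<Rightarrow> real"
  assumes T: "finite T" "D \<inter> T = {}" and att: "attached D T" and K: "1 \<le> K"
    and size: "\<And>t. t \<in> T \<Longrightarrow> K \<le> card {y \<in> T. ldist t y \<le> K}"
    and q: "\<And>A. 0 \<le> q A" and a: "0 \<le> a"
    and pin: "\<And>E x d. D \<subseteq> E \<Longrightarrow> x \<notin> E \<Longrightarrow> d \<in> E \<Longrightarrow> ldist x d \<le> 7 * K \<Longrightarrow>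
      a * q E \<le> q (insert x E)"
  shows "\<exists>k. card T \<le> k * (4 * K + 1)\<^sup>2 \<and> (real K * a) ^ k * q D \<le> (\<Sum>C\<in>Pow T. q (D \<union> C))"
proof -
  from exists_maximal_separated[OF T(1), of "2 * K"] obtain X where "X \<subseteq> T"
      "\<forall>x\<in>X. \<forall>y\<in>X. x \<noteq> y \<longrightarrow> 2 * K < ldist x y" "\<forall>y\<in>T. \<exists>x\<in>X. ldist x y \<le> 2 * K"
    by (elim exE conjE)
  note X = this(1) this(2)[rule_format] this(3)[rule_format]
  have finX: "finite X" using X(1) T(1) by (rule finite_subset)
  define S where "S x = {y \<in> T. ldist x y \<le> K}" for x
  have disj: "S x \<inter> S y = {}" if "x \<in> X" "y \<in> X" "x \<noteq> y" for x y
  proof (rule ccontr)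
    assume "S x \<inter> S y \<noteq> {}"
    then obtain z where "ldist x z \<le> K" "ldist y z \<le> K" by (auto simp: S_def)
    then show False
      using X(2)[OF that] ldist_triangle[of x y z] by (simp add: ldist_commute[of z])
  qed
  have "(real K * a) ^ card X * q D \<le> (\<Sum>C\<in>transversals S X. q (D \<union> C))"
  proof (rule transversal_sum_bound[OF finX _ disj q a])
    show "finite (S x) \<and> K \<le> card (S x)" if "x \<in> X" for x
      using size[of x] that X(1) T(1) by (auto simp: S_def)
    fix Y assume "Y \<subset> X"
    define G where "G = {y \<in> T. \<forall>x\<in>Y. 2 * K < ldist x y}"
    obtain z where "z \<in> X" "z \<notin> Y" using \<open>Y \<subset> X\<close> by auto
    have "2 * K < ldist x z" if "x \<in> Y" for x
      using X(2)[of x z] that \<open>z \<in> X\<close> \<open>z \<notin> Y\<close> \<open>Y \<subset> X\<close> by blast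
    then have "z \<in> G" using \<open>z \<in> X\<close> X(1) unfolding G_def by blast
    moreover have "G \<subseteq> T" by (auto simp: G_def)
    ultimately obtain y y' where y: "y \<in> G" "y' \<in> D \<union> (T - G)" "nbr y y'"
      using att[unfolded attached_def, rule_format, of G] by blast
    obtain x where x: "x \<in> X" "ldist x y \<le> 2 * K"
      using X(3)[of y] y by (auto simp: G_def)
    then have "x \<notin> Y" using y by (auto simp: G_def)
    have "a * q (D \<union> C) \<le> q (insert w (D \<union> C))" if C: "C \<in> transversals S Y" and w: "w \<in> S x" for C w
    proof -
      have xy': "ldist w y' \<le> 3 * K + 1"
        using ldist_triangle[of w y' x] ldist_triangle[of x y' y] x w y(3)
        by (auto simp: S_def ldist_commute[of w] nbr_ldist)
      \<comment> \<open>The distance is at most \<open>3 K + 1\<close> from \<open>w\<close> to \<open>y'\<close>, plus \<open>2 K\<close> to the centre of an open block, plus \<open>K\<close> to its pinned site.\<close>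
      have "\<exists>d\<in>D \<union> C. ldist w d \<le> 7 * K"
      proof (cases "y' \<in> D")
        case True
        then show ?thesis using xy' K by (intro bexI[of _ y']) auto
      next
        case False
        then obtain x' where x': "x' \<in> Y" "ldist x' y' \<le> 2 * K"
          using y by (auto simp: G_def not_less)
        have "C \<inter> S x' \<noteq> {}" using C x'(1) unfolding transversals_def by blast
        then obtain e where e: "e \<in> C" "ldist x' e \<le> K"
          by (auto simp: S_def)
        have "ldist w e \<le> 7 * K"
          using ldist_triangle[of w e y'] ldist_triangle[of y' e x'] ldist_commute[of y' x'] xy'
            x'(2) e(2) K by linarith
        then show ?thesis using e(1) by blast
      qed
      moreover have "w \<notin> D \<union> C"
      proof -
        have "S y \<inter> S x = {}" if "y \<in> Y" for y
          using disj[of y x] that x \<open>x \<notin> Y\<close> \<open>Y \<subset> X\<close> by blast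
        then have "w \<notin> C" using w C unfolding transversals_def by blast
        then show ?thesis using w T(2) by (auto simp: S_def)
      qed
      ultimately show ?thesis using pin[of "D \<union> C" w] by blast
    qed
    then show "\<exists>x\<in>X - Y. \<forall>C\<in>transversals S Y. \<forall>w\<in>S x. a * q (D \<union> C) \<le> q (insert w (D \<union> C))"
      using x(1) \<open>x \<notin> Y\<close> by blast
  qed
  also have "\<dots> \<le> (\<Sum>C\<in>Pow T. q (D \<union> C))"
  proof (rule sum_mono2)
    have "S x \<subseteq> T" for x by (auto simp: S_def)
    then show "transversals S X \<subseteq> Pow T" unfolding transversals_def by blast
  qed (use T q in auto)
  finally have 1: "(real K * a) ^ card X * q D \<le> (\<Sum>C\<in>Pow T. q (D \<union> C))" .
  have "T \<subseteq> (\<Union>x\<in>X. {y. ldist x y \<le> 2 * K})" using X(3) by auto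
  then have "card T \<le> card (\<Union>x\<in>X. {y. ldist x y \<le> 2 * K})"
    by (intro card_mono) (auto simp: finX finite_ldist_ball)
  also have "\<dots> \<le> (\<Sum>x\<in>X. card {y. ldist x y \<le> 2 * K})"
    by (rule card_UN_le[OF finX])
  also have "\<dots> \<le> (\<Sum>x\<in>X. (4 * K + 1)\<^sup>2)"
    by (rule sum_mono) (use card_ldist_ball[of _ "2 * K"] in simp)
  also have "\<dots> = card X * (4 * K + 1)\<^sup>2" by simp
  finally show ?thesis using 1 by blast
qed

section \<open>Attaching a set to the dry set by rays\<close>

definition ray :: "site \<Rightarrow> nat \<Rightarrow> site set" where
  "ray r m = (\<lambda>k. (fst r + int k, snd r)) ` {1..m}"

text \<open>
  The starting site \<open>r\<close> is not tested and not counted, since below it belongs to \<open>E\<close>.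
\<close>

definition free_run :: "site set \<Rightarrow> site \<Rightarrow> nat" where
  "free_run E r = (LEAST k. (fst r + int (Suc k), snd r) \<in> E)"

lemma finite_ray [simp]: "finite (ray r m)"
  by (simp add: ray_def)

lemma card_ray [simp]: "card (ray r m) = m"
  unfolding ray_def by (subst card_image) (auto simp: inj_on_def)

text \<open>
  The complement of the box lies in \<open>E\<close>, so every ray to the right is eventually stopped.
\<close>

lemma free_run_stops:
  assumes "- lattice_box N \<subseteq> E"
  shows "(fst r + int (Suc (free_run E r)), snd r) \<in> E"
proof -
  have "(fst r + int (Suc (nat (\<bar>fst r\<bar> + int N))), snd r) \<notin> lattice_box N"
    by (auto simp: lattice_box_def)
  then have "(fst r + int (Suc (nat (\<bar>fst r\<bar> + int N))), snd r) \<in> E"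
    using assms by blast
  then show ?thesis
    unfolding free_run_def by (rule LeastI)
qed

lemma ray_free_run_disjoint: "ray r (free_run E r) \<inter> E = {}"
proof -
  have "(fst r + int k, snd r) \<notin> E" if "1 \<le> k" "k \<le> free_run E r" for k
  proof -
    have "k - 1 < free_run E r" using that by simp
    then have "(fst r + int (Suc (k - 1)), snd r) \<notin> E"
      unfolding free_run_def by (rule not_less_Least)
    then show ?thesis using that by simp
  qed
  then show ?thesis by (auto simp: ray_def)
qed

lemma rtrancl_leaves:
  assumes "(g, h) \<in> R\<^sup>*" "g \<in> G" "h \<notin> G"
  shows "\<exists>y y'. (y, y') \<in> R \<and> y \<in> G \<and> y' \<notin> G"
  using assms by (induction rule: rtrancl_induct) auto

lemma lattice_connected_bonds_in:
  "lattice_connected C \<Longrightarrow> i \<in> C \<Longrightarrow> j \<in> C \<Longrightarrow> (i, j) \<in> (bonds_in C)\<^sup>*"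
  by (simp add: lattice_connected_def bonds_in_def)

lemma bonds_in_mono: "C \<subseteq> T \<Longrightarrow> (bonds_in C)\<^sup>* \<subseteq> (bonds_in T)\<^sup>*"
  by (intro rtrancl_mono) (auto simp: bonds_in_def)

text \<open>
  A dry set \<open>A\<close> that avoids \<open>B\<close>, the connected pieces \<open>Bs l\<close> of \<open>B\<close>, and a rightmost site \<open>r l\<close> of
  each piece. Rightmost starting points make the rays leave their own piece at once.
\<close>

locale dry_configuration =
  fixes N :: nat and A B :: "site set" and I :: "nat set" and Bs :: "nat \<Rightarrow> site set"
    and r :: "nat \<Rightarrow> site"
  assumes A: "- lattice_box N \<subseteq> A" "A \<inter> B = {}"
    and B: "finite B" "B = (\<Union>l\<in>I. Bs l)" and I: "finite I"
    and disj: "disjoint_family_on Bs I"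
    and conn: "\<And>l. l \<in> I \<Longrightarrow> lattice_connected (Bs l)"
    and r: "\<And>l. l \<in> I \<Longrightarrow> r l \<in> Bs l" "\<And>l y. l \<in> I \<Longrightarrow> y \<in> Bs l \<Longrightarrow> fst y \<le> fst (r l)"
begin

abbreviation (input) run :: "nat \<Rightarrow> nat" where
  "run l \<equiv> free_run (A \<union> B) (r l)"

abbreviation (input) extension :: "site set" where
  "extension \<equiv> B \<union> (\<Union>l\<in>I. ray (r l) (run l))"

lemma finite_extension: "finite extension"
  using B(1) I by auto

lemma dry_extension_disjoint: "A \<inter> extension = {}"
  using A(2) ray_free_run_disjoint[of _ "A \<union> B"] by blast

text \<open>
  Rays on a common row could only overlap if one of them passed through the starting point of the other,
  which is a site of \<open>B\<close> and stops it.
\<close>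

lemma rays_disjoint:
  assumes "l \<in> I" "l' \<in> I" "l \<noteq> l'"
  shows "ray (r l) (run l) \<inter> ray (r l') (run l') = {}"
proof (rule ccontr)
  assume "\<not> ?thesis"
  then obtain p where p: "p \<in> ray (r l) (run l)" "p \<in> ray (r l') (run l')" by blast
  obtain k where "k \<in> {1..run l}" "p = (fst (r l) + int k, snd (r l))"
    using p(1) unfolding ray_def by blast
  moreover obtain k' where "k' \<in> {1..run l'}" "p = (fst (r l') + int k', snd (r l'))"
    using p(2) unfolding ray_def by blast
  ultimately obtain k k' where k: "k \<in> {1..run l}" "k' \<in> {1..run l'}"
      "fst (r l) + int k = fst (r l') + int k'" "snd (r l) = snd (r l')"
    by blast
  have "r l \<in> B" "r l' \<in> B" using r(1) assms B(2) by auto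
  then have no: "r l \<notin> ray (r l') (run l')" "r l' \<notin> ray (r l) (run l)"
    using ray_free_run_disjoint[of _ "A \<union> B"] by blast+
  \<comment> \<open>The ray that needs fewer steps to reach \<open>p\<close> starts on the other one.\<close>
  consider "k < k'" | "k' < k" | "k = k'" by linarith
  then show False
  proof cases
    case 1
    then have "r l = (\<lambda>j. (fst (r l') + int j, snd (r l'))) (k' - k)" "k' - k \<in> {1..run l'}"
      using k by (auto simp: prod_eq_iff)
    then show False using no(1) unfolding ray_def by blast
  next
    case 2
    then have "r l' = (\<lambda>j. (fst (r l) + int j, snd (r l))) (k - k')" "k - k' \<in> {1..run l}"
      using k by (auto simp: prod_eq_iff)
    then show False using no(2) unfolding ray_def by blast
  next
    case 3
    then have "r l = r l'" using k by (simp add: prod_eq_iff)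
    then show False using disj r(1)[OF assms(1)] r(1)[OF assms(2)] assms
      by (auto simp: disjoint_family_on_def)
  qed
qed

lemma card_extension: "card extension = card B + (\<Sum>l\<in>I. run l)"
proof -
  have "card (\<Union>l\<in>I. ray (r l) (run l)) = (\<Sum>l\<in>I. run l)"
    using rays_disjoint by (subst card_UN_disjoint[OF I]) auto
  moreover have "B \<inter> (\<Union>l\<in>I. ray (r l) (run l)) = {}"
    using ray_free_run_disjoint[of _ "A \<union> B"] by blast
  ultimately show ?thesis using B(1) I by (simp add: card_Un_disjoint)
qed

text \<open>
  In a subset \<open>G\<close> of the extension take a site \<open>g\<close> with maximal first coordinate. Moving one step to the
  right leaves \<open>G\<close>, and it stays in the dry set or the extension when \<open>g\<close> lies on a ray. If \<open>g\<close> lies in a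
  component whose rightmost site \<open>r l\<close> is also in \<open>G\<close>, the same step works from \<open>r l\<close>. Otherwise \<open>G\<close>
  contains only a part of that component, and connectedness provides the bond.
\<close>

lemma attached_extension: "attached A extension"
  unfolding attached_def
proof (intro allI impI, elim conjE)
  fix G assume G: "G \<subseteq> extension" "G \<noteq> {}"
  have fin: "finite G" using G(1) finite_extension by (rule finite_subset)
  have "Max (fst ` G) \<in> fst ` G" using fin G(2) by simp
  then obtain g where g: "g \<in> G" "fst g = Max (fst ` G)" by auto
  then have max: "fst y \<le> fst g" if "y \<in> G" for y using fin that by simp
  have right: "\<exists>y\<in>G. \<exists>y'\<in>A \<union> (extension - G). nbr y y'"
    if l: "l \<in> I" and k: "k \<le> run l" and w: "(fst (r l) + int k, snd (r l)) \<in> G"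
      "fst g \<le> fst (r l) + int k" for l k
  proof -
    let ?w' = "(fst (r l) + int (Suc k), snd (r l))"
    have "?w' \<in> A \<union> extension"
    proof (cases "k = run l")
      case True
      then show ?thesis
        using free_run_stops[of N "A \<union> B" "r l"] A(1) by blast
    next
      case False
      then have "Suc k \<in> {1..run l}" using k by simp
      then have "?w' \<in> ray (r l) (run l)" unfolding ray_def by blast
      then show ?thesis using l by blast
    qed
    moreover have "?w' \<notin> G" using max[of ?w'] w by auto
    moreover have "nbr (fst (r l) + int k, snd (r l)) ?w'" by (simp add: nbr_def)
    ultimately show ?thesis using w(1) by blast
  qed
  consider l where "l \<in> I" "g \<in> ray (r l) (run l)" | l where "l \<in> I" "g \<in> Bs l"
    using g(1) G(1) B(2) by blast
  then show "\<exists>y\<in>G. \<exists>y'\<in>A \<union> (extension - G). nbr y y'"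
  proof cases
    case 1
    then obtain k where "k \<le> run l" "g = (fst (r l) + int k, snd (r l))" by (auto simp: ray_def)
    then show ?thesis using right[of l k] 1 g(1) by auto
  next
    case 2
    show ?thesis
    proof (cases "r l \<in> G")
      case True
      then show ?thesis using right[of l 0] 2 r(2)[of l g] by auto
    next
      case False
      have "(g, r l) \<in> (bonds_in (Bs l))\<^sup>*"
        using lattice_connected_bonds_in[OF conn] 2 r(1) by blast
      from rtrancl_leaves[OF this g(1) False] obtain y y' where
        "(y, y') \<in> bonds_in (Bs l)" "y \<in> G" "y' \<notin> G" by blast
      moreover from this have "y' \<in> extension" "nbr y y'"
        using 2 B(2) by (auto simp: bonds_in_def)
      ultimately show ?thesis by blast
    qed
  qed
qed

lemma extension_reaches:
  assumes t: "t \<in> extension"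
  shows "\<exists>l\<in>I. \<forall>u\<in>Bs l. (t, u) \<in> (bonds_in extension)\<^sup>*"
proof -
  have sub: "Bs l \<subseteq> extension" if "l \<in> I" for l using that B(2) by blast
  have inside: "(i, j) \<in> (bonds_in extension)\<^sup>*" if "l \<in> I" "i \<in> Bs l" "j \<in> Bs l" for l i j
    using lattice_connected_bonds_in[OF conn[OF that(1)] that(2,3)] bonds_in_mono[OF sub[OF that(1)]]
    by blast
  consider l where "l \<in> I" "t \<in> ray (r l) (run l)" | l where "l \<in> I" "t \<in> Bs l"
    using t B(2) by blast
  then show ?thesis
  proof cases
    case 1
    have "((fst (r l) + int k, snd (r l)), r l) \<in> (bonds_in extension)\<^sup>*" if "k \<le> run l" for k
      using that
    proof (induction k)
      case 0
      then show ?case by simp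
    next
      case (Suc k)
      have site: "(fst (r l) + int j, snd (r l)) \<in> extension" if "j \<le> run l" for j
      proof (cases "j = 0")
        case True
        then show ?thesis using r(1) sub 1(1) by auto
      next
        case False
        then have "(fst (r l) + int j, snd (r l)) \<in> ray (r l) (run l)"
          using that unfolding ray_def by (intro imageI) simp
        then show ?thesis using 1(1) by blast
      qed
      have "((fst (r l) + int (Suc k), snd (r l)), (fst (r l) + int k, snd (r l))) \<in> bonds_in extension"
        using site[of k] site[of "Suc k"] Suc.prems by (simp add: bonds_in_def nbr_def)
      then show ?case using Suc by (meson Suc_leD converse_rtrancl_into_rtrancl)
    qed
    then have "(t, r l) \<in> (bonds_in extension)\<^sup>*" using 1(2) by (auto simp: ray_def)
    then show ?thesis using inside[OF 1(1) r(1)[OF 1(1)]] 1(1) by (meson rtrancl_trans)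
  next
    case 2
    then show ?thesis using inside by blast
  qed
qed

end


section \<open>Exponential decay\<close>

lemma sup_diam_witness:
  assumes C: "finite C" "C \<noteq> {}" and R: "real R \<le> sup_diam C"
  obtains u v where "u \<in> C" "v \<in> C" "R \<le> ldist u v"
proof -
  let ?f = "\<lambda>(i, j). real_of_int (max \<bar>fst i - fst j\<bar> \<bar>snd i - snd j\<bar>)"
  have "sup_diam C \<in> ?f ` (C \<times> C)"
    unfolding sup_diam_def using C by (intro Max_in) auto
  then obtain u v where uv: "u \<in> C" "v \<in> C"
      "sup_diam C = real_of_int (max \<bar>fst u - fst v\<bar> \<bar>snd u - snd v\<bar>)"
    by auto
  then have "int R \<le> max \<bar>fst u - fst v\<bar> \<bar>snd u - snd v\<bar>"
    using R by linarith
  then have "R \<le> ldist u v" by (auto simp: ldist_def)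
  then show ?thesis using uv that by blast
qed

lemma connected_card_ge_diam:
  assumes "finite C" "lattice_connected C" "real R \<le> sup_diam C"
  shows "R \<le> card C"
proof -
  have "C \<noteq> {}" using assms(2) by (simp add: lattice_connected_def)
  then obtain u v where uv: "u \<in> C" "v \<in> C" "R \<le> ldist u v"
    using sup_diam_witness assms by metis
  have "R \<le> card {y \<in> C. ldist u y \<le> R}"
    by (rule connected_local_size[OF assms(1) lattice_connected_bonds_in[OF assms(2)]]) (use uv in auto)
  also have "\<dots> \<le> card C" using assms(1) by (intro card_mono) auto
  finally show ?thesis .
qed

text \<open>
  Each dry set \<open>A\<close> of the family is dominated by the total weight of the dry sets \<open>A \<union> C\<close> with \<open>C \<subseteq> T\<close>. These
  are distinct for distinct pairs, since \<open>C\<close> is the trace on \<open>T\<close>, so their total weight is at most \<open>1\<close>.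
\<close>

lemma attached_family_bound:
  assumes V: "interaction_potential c V" and K: "1 \<le> K"
    and gain: "exp 1 \<le> real K * (exp J / sqrt (4 * pi * c * real (7 * K)))"
    and T: "finite T" and size: "\<And>t. t \<in> T \<Longrightarrow> K \<le> card {y \<in> T. ldist t y \<le> K}"
    and \<A>: "finite \<A>" "\<And>A. A \<in> \<A> \<Longrightarrow> - lattice_box N \<subseteq> A \<and> A \<inter> T = {} \<and> attached A T"
  shows "(\<Sum>A\<in>\<A>. dry_law N V J A) \<le> exp (- (real (card T) / (real (4 * K + 1))\<^sup>2))"
proof -
  let ?q = "dry_law N V J" and ?a = "exp J / sqrt (4 * pi * c * real (7 * K))"
  let ?w = "real (card T) / (real (4 * K + 1))\<^sup>2"
  have q: "0 \<le> ?q A" for A by (simp add: dry_law_def)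
  have c: "c \<ge> 1" using V by (simp add: interaction_potential_def)
  have each: "exp ?w * ?q A \<le> (\<Sum>C\<in>Pow T. ?q (A \<union> C))" if "A \<in> \<A>" for A
  proof -
    have "\<exists>k. card T \<le> k * (4 * K + 1)\<^sup>2 \<and> (real K * ?a) ^ k * ?q A \<le> (\<Sum>C\<in>Pow T. ?q (A \<union> C))"
    proof (rule attached_pinning_gain[OF T _ _ K size q])
      fix E x d assume "A \<subseteq> E" "x \<notin> E" "d \<in> E" "ldist x d \<le> 7 * K"
      then show "?a * ?q E \<le> ?q (insert x E)"
        using \<A>(2)[OF that] K by (intro dry_law_insert[OF V, where d = d]) auto
    qed (use \<A>(2)[OF that] c in auto)
    then obtain k where k: "card T \<le> k * (4 * K + 1)\<^sup>2"
        "(real K * ?a) ^ k * ?q A \<le> (\<Sum>C\<in>Pow T. ?q (A \<union> C))"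
      by blast
    have "real (card T) \<le> real k * (real (4 * K + 1))\<^sup>2"
      using k(1) by (metis of_nat_le_iff of_nat_mult of_nat_power)
    then have "?w \<le> real k" by (simp add: divide_le_eq)
    then have "exp ?w \<le> exp 1 ^ k" by (simp flip: exp_of_nat_mult)
    also have "\<dots> \<le> (real K * ?a) ^ k" using gain by (intro power_mono) auto
    finally have "exp ?w * ?q A \<le> (real K * ?a) ^ k * ?q A" using q by (rule mult_right_mono)
    with k(2) show ?thesis by linarith
  qed
  let ?f = "\<lambda>(A, C). A \<union> C"
  have inj: "inj_on ?f (\<A> \<times> Pow T)"
  proof (rule inj_onI, clarify)
    fix A C A' C' assume *: "A \<in> \<A>" "A' \<in> \<A>" "C \<subseteq> T" "C' \<subseteq> T" "A \<union> C = A' \<union> C'"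
    then show "A = A' \<and> C = C'" using \<A>(2)[of A] \<A>(2)[of A'] by blast
  qed
  have "exp ?w * (\<Sum>A\<in>\<A>. ?q A) = (\<Sum>A\<in>\<A>. exp ?w * ?q A)" by (simp add: sum_distrib_left)
  also have "\<dots> \<le> (\<Sum>A\<in>\<A>. \<Sum>C\<in>Pow T. ?q (A \<union> C))" by (rule sum_mono[OF each])
  also have "\<dots> = (\<Sum>p\<in>\<A> \<times> Pow T. ?q (?f p))"
    by (simp add: sum.cartesian_product case_prod_beta)
  also have "\<dots> = (\<Sum>E\<in>?f ` (\<A> \<times> Pow T). ?q E)"
    by (simp add: sum.reindex[OF inj])
  also have "\<dots> \<le> 1"
    using \<A>(1) T by (intro sum_dry_law_le_1[OF V]) auto
  finally show ?thesis by (simp add: exp_minus field_simps)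
qed

text \<open>
  The product behaves like a constant times \<open>sqrt K\<close>: the number of choices beats the cost.
\<close>

lemma exists_pinning_scale:
  assumes "0 < c"
  obtains K :: nat where "1 \<le> K" "exp 1 \<le> real K * (exp J / sqrt (4 * pi * c * real (7 * K)))"
proof -
  \<comment> \<open>The factor to be bounded equals \<open>exp 1 * sqrt K / ?x\<close>, with \<open>28 = 4 * 7\<close>.\<close>
  let ?x = "exp 1 * sqrt (28 * pi * c) / exp J"
  obtain K :: nat where K: "max 1 (?x\<^sup>2) \<le> real K" using real_arch_simple by blast
  have "?x \<le> sqrt (real K)" using K by (intro real_le_rsqrt) simp
  then have "exp 1 * sqrt (28 * pi * c) \<le> exp J * sqrt (real K)" by (simp add: field_simps)
  moreover have "real K * (exp J / sqrt (4 * pi * c * real (7 * K)))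
      = exp J * sqrt (real K) / sqrt (28 * pi * c)"
  proof -
    have "sqrt (4 * pi * c * real (7 * K)) = sqrt (28 * pi * c) * sqrt (real K)"
      by (simp add: real_sqrt_mult[symmetric] ac_simps)
    then have "real K * (exp J / sqrt (4 * pi * c * real (7 * K)))
        = exp J * (real K / sqrt (real K)) / sqrt (28 * pi * c)"
      by (simp add: ac_simps)
    then show ?thesis by (simp add: real_div_sqrt)
  qed
  moreover have "0 < sqrt (28 * pi * c)" using assms by simp
  ultimately have "exp 1 \<le> real K * (exp J / sqrt (4 * pi * c * real (7 * K)))"
    by (simp only: pos_le_divide_eq)
  moreover have "1 \<le> K" using K by simp
  ultimately show ?thesis by (intro that)
qed

theorem theorem3:
  fixes J c :: real
  shows "\<exists>R \<nu> :: real. \<nu> > 0 \<and>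
    (\<forall>V. interaction_potential c V \<longrightarrow>
      (\<forall>(N :: nat) (B :: site set) (n :: nat) (Bs :: nat \<Rightarrow> site set).
        finite B \<and>
        B = (\<Union>l\<in>{1..n}. Bs l) \<and>
        disjoint_family_on Bs {1..n} \<and>
        (\<forall>l\<in>{1..n}. connected_comp B (Bs l)) \<and>
        (\<forall>l\<in>{1..n}. sup_diam (Bs l) \<ge> R) \<longrightarrow>
        (\<Sum>A | - lattice_box N \<subseteq> A \<and> A \<inter> B = {}. dry_law N V J A) \<le> exp (- \<nu> * real (card B))))"
proof (cases "c \<ge> 1")
  case False
  then show ?thesis by (auto simp: interaction_potential_def intro!: exI[of _ 1])
next
  case True
  then have "0 < c" by simp
  obtain K :: nat where K: "1 \<le> K" "exp 1 \<le> real K * (exp J / sqrt (4 * pi * c * real (7 * K)))"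
    using exists_pinning_scale[OF \<open>0 < c\<close>] by blast
  \<comment> \<open>The gain per site is \<open>2 \<nu>\<close>: one half remains in the final bound, the other pays for the entropy of the rays.\<close>
  define \<nu> where "\<nu> = 1 / (2 * (real (4 * K + 1))\<^sup>2)"
  have \<nu>: "0 < \<nu>" "1 / (real (4 * K + 1))\<^sup>2 = 2 * \<nu>" by (auto simp: \<nu>_def)
  define x where "x = exp (- 2 * \<nu>)"
  have x: "0 < x" "x < 1" using \<nu> by (auto simp: x_def)
  \<comment> \<open>The first bound makes the blocks of scale \<open>K\<close> fit into each component, the second absorbs the sum over one ray length.\<close>
  obtain R :: nat where R: "max (real (2 * K)) (ln (1 / (1 - x)) / \<nu>) \<le> real R"
    using real_arch_simple by blast
  have entropy: "1 / (1 - x) \<le> exp (\<nu> * real R)"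
  proof -
    have "ln (1 / (1 - x)) \<le> \<nu> * real R" using R \<nu> by (simp add: field_simps)
    moreover have "0 < 1 / (1 - x)" using x by simp
    ultimately show ?thesis by (metis exp_le_cancel_iff exp_ln)
  qed
  have "(\<Sum>A | - lattice_box N \<subseteq> A \<and> A \<inter> B = {}. dry_law N V J A) \<le> exp (- \<nu> * real (card B))"
    if V: "interaction_potential c V" and B: "finite B" "B = (\<Union>l\<in>{1..n}. Bs l)"
      and disj: "disjoint_family_on Bs {1..n}" and comp: "\<forall>l\<in>{1..n}. connected_comp B (Bs l)"
      and diam: "\<forall>l\<in>{1..n}. real R \<le> sup_diam (Bs l)"
    for V and N n :: nat and B :: "site set" and Bs :: "nat \<Rightarrow> site set"
  proof -
    let ?I = "{1..n}"
    define \<A> where "\<A> = {A. - lattice_box N \<subseteq> A \<and> A \<inter> B = {}}"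
    have fin\<A>: "finite \<A>" unfolding \<A>_def by (rule finite_supersets_compl_box)
    have conn: "lattice_connected (Bs l)" and finBs: "finite (Bs l)" and ne: "Bs l \<noteq> {}" if "l \<in> ?I" for l
    proof -
      show conn: "lattice_connected (Bs l)"
        using comp that by (simp add: connected_comp_def)
      show "finite (Bs l)"
        by (rule finite_subset[OF _ B(1)]) (use comp that in \<open>simp add: connected_comp_def\<close>)
      from conn show "Bs l \<noteq> {}" by (simp add: lattice_connected_def)
    qed
    have "\<forall>l\<in>?I. \<exists>p\<in>Bs l. \<forall>y\<in>Bs l. fst y \<le> fst p"
    proof
      fix l assume l: "l \<in> ?I"
      have "Max (fst ` Bs l) \<in> fst ` Bs l" using finBs[OF l] ne[OF l] by simp
      then obtain p where "p \<in> Bs l" "fst p = Max (fst ` Bs l)" by auto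
      then show "\<exists>p\<in>Bs l. \<forall>y\<in>Bs l. fst y \<le> fst p" using finBs[OF l] by (intro bexI[of _ p]) auto
    qed
    then obtain r where r: "\<And>l. l \<in> ?I \<Longrightarrow> r l \<in> Bs l"
        "\<And>l y. l \<in> ?I \<Longrightarrow> y \<in> Bs l \<Longrightarrow> fst y \<le> fst (r l)"
      by metis
    \<comment> \<open>The ray lengths; classifying the dry sets by them makes the extension the same within a class.\<close>
    define M where "M A = (\<lambda>l\<in>?I. free_run (A \<union> B) (r l))" for A
    have A: "- lattice_box N \<subseteq> A" "A \<inter> B = {}" if "A \<in> \<A>" for A
      using that by (auto simp: \<A>_def)
    have config: "dry_configuration N A B ?I Bs r" if "A \<in> \<A>" for A
      by unfold_locales (use A[OF that] B disj conn r in auto)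
    have pattern: "(\<Sum>A | A \<in> \<A> \<and> M A = \<mu>. dry_law N V J A) \<le> x ^ (card B + (\<Sum>l\<in>?I. \<mu> l))"
      if "\<mu> \<in> M ` \<A>" for \<mu>
    proof -
      define T where "T = B \<union> (\<Union>l\<in>?I. ray (r l) (\<mu> l))"
      have ext: "B \<union> (\<Union>l\<in>?I. ray (r l) (free_run (A \<union> B) (r l))) = T" if "M A = \<mu>" for A
        using that by (auto simp: T_def M_def)
      obtain A0 where A0: "A0 \<in> \<A>" "M A0 = \<mu>" using \<open>\<mu> \<in> M ` \<A>\<close> by auto
      have cardT: "card T = card B + (\<Sum>l\<in>?I. \<mu> l)"
      proof -
        have "(\<Sum>l\<in>?I. free_run (A0 \<union> B) (r l)) = (\<Sum>l\<in>?I. \<mu> l)"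
          using A0(2) by (intro sum.cong) (auto simp: M_def)
        then show ?thesis
          using dry_configuration.card_extension[OF config[OF A0(1)]] unfolding ext[OF A0(2)] by simp
      qed
      have size: "K \<le> card {y \<in> T. ldist t y \<le> K}" if t: "t \<in> T" for t
      proof -
        obtain l where l: "l \<in> ?I" "\<And>u. u \<in> Bs l \<Longrightarrow> (t, u) \<in> (bonds_in T)\<^sup>*"
          using dry_configuration.extension_reaches[OF config[OF A0(1)], of t] t
          unfolding ext[OF A0(2)] by blast
        have "real (2 * K) \<le> sup_diam (Bs l)" using R diam l(1) by force
        then obtain u v where uv: "u \<in> Bs l" "v \<in> Bs l" "2 * K \<le> ldist u v"
          using sup_diam_witness[OF finBs[OF l(1)] ne[OF l(1)]] by metis
        have "K \<le> ldist t u \<or> K \<le> ldist t v"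
          using ldist_triangle[of u v t] uv(3) by (simp add: ldist_commute[of u t]) linarith
        moreover have "finite T" using B(1) by (simp add: T_def)
        ultimately show ?thesis using connected_local_size l(2) uv(1,2) t by blast
      qed
      have "(\<Sum>A | A \<in> \<A> \<and> M A = \<mu>. dry_law N V J A) \<le> exp (- (real (card T) / (real (4 * K + 1))\<^sup>2))"
      proof (rule attached_family_bound[OF V K _ size])
        show "finite T" using B(1) by (simp add: T_def)
        fix A' assume "A' \<in> {A. A \<in> \<A> \<and> M A = \<mu>}"
        then have A': "A' \<in> \<A>" "M A' = \<mu>" by auto
        show "- lattice_box N \<subseteq> A' \<and> A' \<inter> T = {} \<and> attached A' T"
          using A[OF A'(1)] dry_configuration.dry_extension_disjoint[OF config[OF A'(1)]]
            dry_configuration.attached_extension[OF config[OF A'(1)]]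
          unfolding ext[OF A'(2)] by blast
      qed (use fin\<A> in auto)
      also have "\<dots> = x ^ card T"
      proof -
        have "real (card T) / (real (4 * K + 1))\<^sup>2 = real (card T) * (2 * \<nu>)"
          unfolding \<nu>(2)[symmetric] by simp
        then show ?thesis by (simp add: x_def exp_of_nat_mult[symmetric])
      qed
      finally show ?thesis by (simp only: cardT)
    qed
    have runs: "(\<Prod>l\<in>?I. \<Sum>k\<le>b. x ^ k) \<le> exp (\<nu> * real (card B))" for b
    proof -
      have "(\<Prod>l\<in>?I. \<Sum>k\<le>b. x ^ k) \<le> (1 / (1 - x)) ^ n"
      proof -
        have "(\<Sum>k\<le>b. x ^ k) \<le> 1 / (1 - x)"
        proof -
          have "(\<Sum>k\<le>b. x ^ k) = (1 - x ^ Suc b) / (1 - x)" using x sum_gp0[of x b] by simp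
          also have "\<dots> \<le> 1 / (1 - x)" using x by (intro divide_right_mono) auto
          finally show ?thesis .
        qed
        then have "(\<Sum>k\<le>b. x ^ k) ^ n \<le> (1 / (1 - x)) ^ n"
          using x by (intro power_mono) (auto intro: sum_nonneg)
        then show ?thesis by simp
      qed
      also have "\<dots> \<le> exp (\<nu> * real R) ^ n"
        using entropy x by (intro power_mono) auto
      also have "\<dots> = exp (\<nu> * real (n * R))"
        by (simp add: exp_of_nat_mult[symmetric] ac_simps)
      also have "\<dots> \<le> exp (\<nu> * real (card B))"
      proof -
        have "n * R = (\<Sum>l\<in>?I. R)" by simp
        also have "\<dots> \<le> (\<Sum>l\<in>?I. card (Bs l))"
          using finBs conn diam by (intro sum_mono connected_card_ge_diam) auto
        also have "\<dots> = card B"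
          unfolding B(2) using finBs disj by (subst card_UN_disjoint) (auto simp: disjoint_family_on_def)
        finally have "real (n * R) \<le> real (card B)" by (rule of_nat_mono)
        then show ?thesis using \<nu>(1) by (simp only: exp_le_cancel_iff mult_le_cancel_left_pos)
      qed
      finally show ?thesis .
    qed
    \<comment> \<open>A common bound makes the range of the length vectors a finite product, over which the sum factorises into geometric sums.\<close>
    obtain b where b: "\<And>A l. A \<in> \<A> \<Longrightarrow> l \<in> ?I \<Longrightarrow> M A l \<le> b"
    proof -
      have "finite ((\<lambda>(A, l). M A l) ` (\<A> \<times> ?I))" using fin\<A> by simp
      then obtain b where "\<forall>m\<in>(\<lambda>(A, l). M A l) ` (\<A> \<times> ?I). m \<le> b"
        using finite_nat_set_iff_bounded_le by blast
      then show ?thesis by (intro that[of b]) auto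
    qed
    have range: "M ` \<A> \<subseteq> Pi\<^sub>E ?I (\<lambda>_. {..b})"
      using b by (auto simp: M_def PiE_def Pi_def)
    have fin: "finite (Pi\<^sub>E ?I (\<lambda>_. {..b}))" by (intro finite_PiE) auto
    have "(\<Sum>A\<in>\<A>. dry_law N V J A) = (\<Sum>\<mu>\<in>M ` \<A>. \<Sum>A | A \<in> \<A> \<and> M A = \<mu>. dry_law N V J A)"
      by (rule sum.image_gen[OF fin\<A>])
    also have "\<dots> \<le> (\<Sum>\<mu>\<in>M ` \<A>. x ^ (card B + (\<Sum>l\<in>?I. \<mu> l)))"
      by (rule sum_mono[OF pattern])
    also have "\<dots> \<le> (\<Sum>\<mu>\<in>Pi\<^sub>E ?I (\<lambda>_. {..b}). x ^ (card B + (\<Sum>l\<in>?I. \<mu> l)))"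
      using x by (intro sum_mono2[OF fin range]) auto
    also have "\<dots> = x ^ card B * (\<Sum>\<mu>\<in>Pi\<^sub>E ?I (\<lambda>_. {..b}). \<Prod>l\<in>?I. x ^ \<mu> l)"
      by (simp add: power_add power_sum sum_distrib_left)
    also have "(\<Sum>\<mu>\<in>Pi\<^sub>E ?I (\<lambda>_. {..b}). \<Prod>l\<in>?I. x ^ \<mu> l) = (\<Prod>l\<in>?I. \<Sum>k\<le>b. x ^ k)"
      by (rule prod_sum_PiE[symmetric]) auto
    also have "x ^ card B * \<dots> \<le> x ^ card B * exp (\<nu> * real (card B))"
      using x runs by (intro mult_left_mono) auto
    also have "\<dots> = exp (- \<nu> * real (card B))"
      by (simp add: x_def exp_of_nat_mult[symmetric] exp_add[symmetric] algebra_simps)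
    finally show ?thesis by (simp add: \<A>_def)
  qed
  then show ?thesis
    using \<nu>(1)
    by - (rule exI[of _ "real R"], rule exI[of _ \<nu>], intro conjI allI impI, assumption, elim conjE, blast)
qed

end
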